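(* Let $\varphi$ be a closed $\mu\mathrm{HML}$ formula. There is a monitor $m\in\mathrm{Mon}$ that is sound for $[\![\varphi]\!]$ and violation-persistently informative (i.e. for every $s\in\mathrm{Act}^*$ there is $f\in\mathrm{Act}^\infty$ with $\mathrm{rej}(m,sf)$) if and only if there is $\psi\in\mathrm{SPIHML}$ with $[\![\psi]\!]=[\![\varphi]\!]$. Likewise, there is a monitor $m\in\mathrm{Mon}$ that is sound for $[\![\varphi]\!]$ and satisfaction-persistently informative (for every $s\in\mathrm{Act}^*$ there is $f$ with $\mathrm{acc}(m,sf)$) if and only if there is $\psi\in\mathrm{CPIHML}$ with $[\![\psi]\!]=[\![\varphi]\!]$.
   Context: $\mathrm{Act}$ is a finite set of actions, $\mathrm{Act}^\infty=\mathrm{Act}^*\cup\mathrm{Act}^\omega$. Logic $\mu\mathrm{HML}$: $\varphi::=\mathsf{tt}\mid\mathsf{ff}\mid\varphi\lor\varphi\mid\varphi\land\varphi\mid\langle a\rangle\varphi\mid[a]\varphi\mid\min X.\varphi\mid\max X.\varphi\mid X$, interpreted over $\mathrm{Act}^\infty$: $[\![\mathsf{tt}]\!]=\mathrm{Act}^\infty$, $[\![\mathsf{ff}]\!]=\emptyset$, $\lor,\land$ union/intersection, $[\![[a]\varphi]\!]=\{f\mid f=af'\Rightarrow f'\in[\![\varphi]\!]\}$, $[\![\langle a\rangle\varphi]\!]=\{af\mid f\in[\![\varphi]\!]\}$, $\min X$/$\max X$ least/greatest fixpoints (with valuations for variables). Formulae are closed and guarded. $\mathrm{sHML}$: $\varphi::=\mathsf{tt}\mid\mathsf{ff}\mid[a]\varphi\mid\varphi\land\varphi\mid\max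 X.\varphi\mid X$; $\mathrm{cHML}$: $\varphi::=\mathsf{tt}\mid\mathsf{ff}\mid\langle a\rangle\varphi\mid\varphi\lor\varphi\mid\min X.\varphi\mid X$. The explicit fragment $\mathrm{eHML}$: $\varphi::=\mathsf{tt}\mid\mathsf{ff}\mid\min X.\varphi\mid\max X.\varphi\mid X\mid\varphi\lor\varphi\mid\varphi\land\varphi\mid\bigvee_{a\in\mathrm{Act}}\langle a\rangle\varphi_a\mid\bigwedge_{a\in\mathrm{Act}}[a]\varphi_a$. For a closed $\mathrm{sHML}$ (resp. $\mathrm{cHML}$) formula $\varphi$, a subformula $\psi$ of $\varphi$ can refute (resp. verify) in $0$ unfoldings if $\mathsf{ff}$ (resp. $\mathsf{tt}$) occurs in $\psi$; it can refute (resp. verify) in $k+1$ unfoldings if it can in $k$ unfoldings, or $X$ occurs in $\psi$ and $\psi$ is in the scope of a subformula $\max X.\psi'$ (resp. $\min X.\psi'$) that can refute (resp. verify) in $k$ unfoldings; it can refute (verify) if it can in $k$ unfoldings for some $k\ge0$. $\mathrm{SPIHML}=\{\varphi_1\land\varphi_2\in\mu\mathrm{HML}\mid\varphi_1\in\mathrm{sHML}\cap\mathrm{eHML}\text{ and every subformula of }\varphi_1\text{ can refute}\}$; $\mathrm{CPIHML}=\{\varphi_1\lor\varphi_2\in\mu\mathrm{HML}\mid\varphi_1\in\mathrm{cHML}\cap\mathrm{eHML}\text{ and every subformula of }\varphi_1\text{ can verify}\}$. Monitors $\mathrm{Mon}$: closed terms $m::=v\mid a.m\mid m+m\mid m\otimes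 m\mid m\oplus m\mid\mathrm{rec}\,x.m\mid x$, $v\in\{\mathsf{end},\mathsf{no},\mathsf{yes}\}$, with transitions: $a.m\xrightarrow{a}m$; $v\xrightarrow{a}v$; $\mathrm{rec}\,x.m\xrightarrow{a}n$ if $m[\mathrm{rec}\,x.m/x]\xrightarrow{a}n$; $m+n\xrightarrow{a}m'$ if $m\xrightarrow{a}m'$ (and symmetrically); for $\odot\in\{\otimes,\oplus\}$: $m\odot n\xrightarrow{a}m'\odot n'$ if both components make the $a$-step; $m\odot n\xrightarrow{\tau}m'\odot n$ if $m\xrightarrow{\tau}m'$ (and symmetrically); $\mathsf{end}\odot\mathsf{end}\xrightarrow{\tau}\mathsf{end}$; $\mathsf{yes}\otimes m\xrightarrow{\tau}m$, $\mathsf{no}\otimes m\xrightarrow{\tau}\mathsf{no}$, $\mathsf{no}\oplus m\xrightarrow{\tau}m$, $\mathsf{yes}\oplus m\xrightarrow{\tau}\mathsf{yes}$ (also symmetrically). $\mathrm{acc}(m,s)$/$\mathrm{rej}(m,s)$ for finite $s$: $m$ reaches $\mathsf{yes}$/$\mathsf{no}$ via transitions with visible labels $s$ interleaved with $\tau$-steps; for infinite $t$: for some finite prefix of $t$. $m$ is sound for $P$ if $\mathrm{acc}(m,f)\Rightarrow f\in P$ and $\mathrm{rej}(m,f)\Rightarrow f\notin P$. *)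

theory Defs
  imports Main "HOL-Library.Stream"
begin

datatype 'a trace = Fin "'a list" | Inf "'a stream"

fun tapp :: "'a list \<Rightarrow> 'a trace \<Rightarrow> 'a trace" where
  "tapp s (Fin u) = Fin (s @ u)"
| "tapp s (Inf t) = Inf (s @- t)"

definition tcons :: "'a \<Rightarrow> 'a trace \<Rightarrow> 'a trace" where
  "tcons a f = tapp [a] f"

type_synonym var = nat

datatype 'a fm =
    TT
  | FF
  | Or "'a fm" "'a fm"
  | And "'a fm" "'a fm"
  | Dia 'a "'a fm"
  | Box 'a "'a fm"
  | FMin var "'a fm"
  | FMax var "'a fm"
  | Var var

primrec eval :: "'a fm \<Rightarrow> (var \<Rightarrow> 'a trace set) \<Rightarrow> 'a trace set" where
  "eval TT \<rho> = UNIV"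
| "eval FF \<rho> = {}"
| "eval (Or \<phi> \<psi>) \<rho> = eval \<phi> \<rho> \<union> eval \<psi> \<rho>"
| "eval (And \<phi> \<psi>) \<rho> = eval \<phi> \<rho> \<inter> eval \<psi> \<rho>"
| "eval (Dia a \<phi>) \<rho> = {tcons a f | f. f \<in> eval \<phi> \<rho>}"
| "eval (Box a \<phi>) \<rho> = {f. \<forall>f'. f = tcons a f' \<longrightarrow> f' \<in> eval \<phi> \<rho>}"
| "eval (FMin X \<phi>) \<rho> = lfp (\<lambda>S. eval \<phi> (\<rho>(X := S)))"
| "eval (FMax X \<phi>) \<rho> = gfp (\<lambda>S. eval \<phi> (\<rho>(X := S)))"
| "eval (Var X) \<rho> = \<rho> X"

text \<open>Only used for closed formulae, whose meaning does not depend on the valuation.\<close>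

definition sem :: "'a fm \<Rightarrow> 'a trace set" where
  "sem \<phi> = eval \<phi> (\<lambda>_. {})"

primrec fv :: "'a fm \<Rightarrow> var set" where
  "fv TT = {}"
| "fv FF = {}"
| "fv (Or \<phi> \<psi>) = fv \<phi> \<union> fv \<psi>"
| "fv (And \<phi> \<psi>) = fv \<phi> \<union> fv \<psi>"
| "fv (Dia a \<phi>) = fv \<phi>"
| "fv (Box a \<phi>) = fv \<phi>"
| "fv (FMin X \<phi>) = fv \<phi> - {X}"
| "fv (FMax X \<phi>) = fv \<phi> - {X}"
| "fv (Var X) = {X}"

text \<open>The variables with a free occurrence that is not below any modality.\<close>

primrec unguarded :: "'a fm \<Rightarrow> var set" where
  "unguarded TT = {}"
| "unguarded FF = {}"
| "unguarded (Or \<phi> \<psi>) = unguarded \<phi> \<union> unguarded \<psi>"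
| "unguarded (And \<phi> \<psi>) = unguarded \<phi> \<union> unguarded \<psi>"
| "unguarded (Dia a \<phi>) = {}"
| "unguarded (Box a \<phi>) = {}"
| "unguarded (FMin X \<phi>) = unguarded \<phi> - {X}"
| "unguarded (FMax X \<phi>) = unguarded \<phi> - {X}"
| "unguarded (Var X) = {X}"

primrec guarded :: "'a fm \<Rightarrow> bool" where
  "guarded TT = True"
| "guarded FF = True"
| "guarded (Or \<phi> \<psi>) = (guarded \<phi> \<and> guarded \<psi>)"
| "guarded (And \<phi> \<psi>) = (guarded \<phi> \<and> guarded \<psi>)"
| "guarded (Dia a \<phi>) = guarded \<phi>"
| "guarded (Box a \<phi>) = guarded \<phi>"
| "guarded (FMin X \<phi>) = (X \<notin> unguarded \<phi> \<and> guarded \<phi>)"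
| "guarded (FMax X \<phi>) = (X \<notin> unguarded \<phi> \<and> guarded \<phi>)"
| "guarded (Var X) = True"

definition muHML :: "'a fm set" where
  "muHML = {\<phi>. fv \<phi> = {} \<and> guarded \<phi>}"

text \<open>The fragments are grammars and hence contain open formulae as well.\<close>

inductive_set sHML :: "'a fm set" where
  "TT \<in> sHML"
| "FF \<in> sHML"
| "\<phi> \<in> sHML \<Longrightarrow> Box a \<phi> \<in> sHML"
| "\<phi> \<in> sHML \<Longrightarrow> \<psi> \<in> sHML \<Longrightarrow> And \<phi> \<psi> \<in> sHML"
| "\<phi> \<in> sHML \<Longrightarrow> FMax X \<phi> \<in> sHML"
| "Var X \<in> sHML"

inductive_set cHML :: "'a fm set" where
  "TT \<in> cHML"
| "FF \<in> cHML"
| "\<phi> \<in> cHML \<Longrightarrow> Dia a \<phi> \<in> cHML"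
| "\<phi> \<in> cHML \<Longrightarrow> \<psi> \<in> cHML \<Longrightarrow> Or \<phi> \<psi> \<in> cHML"
| "\<phi> \<in> cHML \<Longrightarrow> FMin X \<phi> \<in> cHML"
| "Var X \<in> cHML"

text \<open>
  \<open>big_dia A F \<chi>\<close>: the formula \<open>\<chi>\<close> is the disjunction of the \<open>Dia a (F a)\<close> over all
  \<open>a \<in> A\<close>, each occurring once, in some order and with some bracketing. Dually for
  \<open>big_box\<close>.
\<close>

inductive big_dia :: "'a set \<Rightarrow> ('a \<Rightarrow> 'a fm) \<Rightarrow> 'a fm \<Rightarrow> bool" where
  "big_dia {a} F (Dia a (F a))"
| "big_dia A F \<chi> \<Longrightarrow> big_dia B F \<chi>' \<Longrightarrow> A \<inter> B = {} \<Longrightarrow> big_dia (A \<union> B) F (Or \<chi> \<chi>')"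

inductive big_box :: "'a set \<Rightarrow> ('a \<Rightarrow> 'a fm) \<Rightarrow> 'a fm \<Rightarrow> bool" where
  "big_box {a} F (Box a (F a))"
| "big_box A F \<chi> \<Longrightarrow> big_box B F \<chi>' \<Longrightarrow> A \<inter> B = {} \<Longrightarrow> big_box (A \<union> B) F (And \<chi> \<chi>')"

inductive_set eHML :: "'a fm set" where
  "TT \<in> eHML"
| "FF \<in> eHML"
| "\<phi> \<in> eHML \<Longrightarrow> FMin X \<phi> \<in> eHML"
| "\<phi> \<in> eHML \<Longrightarrow> FMax X \<phi> \<in> eHML"
| "Var X \<in> eHML"
| "\<phi> \<in> eHML \<Longrightarrow> \<psi> \<in> eHML \<Longrightarrow> Or \<phi> \<psi> \<in> eHML"
| "\<phi> \<in> eHML \<Longrightarrow> \<psi> \<in> eHML \<Longrightarrow> And \<phi> \<psi> \<in> eHML"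
| "(\<And>a. F a \<in> eHML) \<Longrightarrow> big_dia UNIV F \<chi> \<Longrightarrow> \<chi> \<in> eHML"
| "(\<And>a. F a \<in> eHML) \<Longrightarrow> big_box UNIV F \<chi> \<Longrightarrow> \<chi> \<in> eHML"

text \<open>
  An occurrence of a subformula is a pair \<open>(\<Gamma>, \<psi>)\<close>, where \<open>\<Gamma>\<close> lists the fixpoint
  subformulae that have this occurrence in their scope, innermost first. All
  subformula occurrences of \<open>\<phi>\<close> are given by \<open>occs [] \<phi>\<close>.
\<close>

fun occs :: "'a fm list \<Rightarrow> 'a fm \<Rightarrow> ('a fm list \<times> 'a fm) set" where
  "occs \<Gamma> (Or \<phi> \<psi>) = insert (\<Gamma>, Or \<phi> \<psi>) (occs \<Gamma> \<phi> \<union> occs \<Gamma> \<psi>)"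
| "occs \<Gamma> (And \<phi> \<psi>) = insert (\<Gamma>, And \<phi> \<psi>) (occs \<Gamma> \<phi> \<union> occs \<Gamma> \<psi>)"
| "occs \<Gamma> (Dia a \<phi>) = insert (\<Gamma>, Dia a \<phi>) (occs \<Gamma> \<phi>)"
| "occs \<Gamma> (Box a \<phi>) = insert (\<Gamma>, Box a \<phi>) (occs \<Gamma> \<phi>)"
| "occs \<Gamma> (FMin X \<phi>) = insert (\<Gamma>, FMin X \<phi>) (occs (FMin X \<phi> # \<Gamma>) \<phi>)"
| "occs \<Gamma> (FMax X \<phi>) = insert (\<Gamma>, FMax X \<phi>) (occs (FMax X \<phi> # \<Gamma>) \<phi>)"
| "occs \<Gamma> TT = {(\<Gamma>, TT)}"
| "occs \<Gamma> FF = {(\<Gamma>, FF)}"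
| "occs \<Gamma> (Var X) = {(\<Gamma>, Var X)}"

definition occurs_in :: "'a fm \<Rightarrow> 'a fm \<Rightarrow> bool" where
  "occurs_in \<chi> \<psi> \<longleftrightarrow> (\<exists>\<Delta>. (\<Delta>, \<chi>) \<in> occs [] \<psi>)"

definition binds :: "var \<Rightarrow> 'a fm \<Rightarrow> bool" where
  "binds X \<theta> \<longleftrightarrow> (\<exists>\<psi>. \<theta> = FMin X \<psi> \<or> \<theta> = FMax X \<psi>)"

text \<open>
  Variable names may be rebound, so the occurrence of \<open>X\<close> in \<open>\<psi>\<close> is required to be free
  and the enclosing fixpoint to be the innermost one binding \<open>X\<close>, i.e. the one to which
  this occurrence of \<open>X\<close> refers. Under the convention that all bound variables are
  distinct, both requirements hold automatically for variables bound outside \<open>\<psi>\<close>.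
\<close>

primrec can_refute_in :: "nat \<Rightarrow> 'a fm list \<Rightarrow> 'a fm \<Rightarrow> bool" where
  "can_refute_in 0 \<Gamma> \<psi> \<longleftrightarrow> occurs_in FF \<psi>"
| "can_refute_in (Suc k) \<Gamma> \<psi> \<longleftrightarrow> can_refute_in k \<Gamma> \<psi> \<or>
     (\<exists>X \<psi>' \<Gamma>\<^sub>1 \<Gamma>\<^sub>2. X \<in> fv \<psi> \<and> \<Gamma> = \<Gamma>\<^sub>1 @ FMax X \<psi>' # \<Gamma>\<^sub>2 \<and> (\<forall>\<theta>\<in>set \<Gamma>\<^sub>1. \<not> binds X \<theta>) \<and>
        can_refute_in k \<Gamma>\<^sub>2 (FMax X \<psi>'))"

primrec can_verify_in :: "nat \<Rightarrow> 'a fm list \<Rightarrow> 'a fm \<Rightarrow> bool" where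
  "can_verify_in 0 \<Gamma> \<psi> \<longleftrightarrow> occurs_in TT \<psi>"
| "can_verify_in (Suc k) \<Gamma> \<psi> \<longleftrightarrow> can_verify_in k \<Gamma> \<psi> \<or>
     (\<exists>X \<psi>' \<Gamma>\<^sub>1 \<Gamma>\<^sub>2. X \<in> fv \<psi> \<and> \<Gamma> = \<Gamma>\<^sub>1 @ FMin X \<psi>' # \<Gamma>\<^sub>2 \<and> (\<forall>\<theta>\<in>set \<Gamma>\<^sub>1. \<not> binds X \<theta>) \<and>
        can_verify_in k \<Gamma>\<^sub>2 (FMin X \<psi>'))"

definition can_refute :: "'a fm list \<Rightarrow> 'a fm \<Rightarrow> bool" where
  "can_refute \<Gamma> \<psi> \<longleftrightarrow> (\<exists>k. can_refute_in k \<Gamma> \<psi>)"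

definition can_verify :: "'a fm list \<Rightarrow> 'a fm \<Rightarrow> bool" where
  "can_verify \<Gamma> \<psi> \<longleftrightarrow> (\<exists>k. can_verify_in k \<Gamma> \<psi>)"

definition SPIHML :: "'a fm set" where
  "SPIHML = {And \<phi>\<^sub>1 \<phi>\<^sub>2 | \<phi>\<^sub>1 \<phi>\<^sub>2. And \<phi>\<^sub>1 \<phi>\<^sub>2 \<in> muHML \<and> \<phi>\<^sub>1 \<in> sHML \<inter> eHML \<and>
     (\<forall>(\<Gamma>, \<psi>) \<in> occs [] \<phi>\<^sub>1. can_refute \<Gamma> \<psi>)}"

definition CPIHML :: "'a fm set" where
  "CPIHML = {Or \<phi>\<^sub>1 \<phi>\<^sub>2 | \<phi>\<^sub>1 \<phi>\<^sub>2. Or \<phi>\<^sub>1 \<phi>\<^sub>2 \<in> muHML \<and> \<phi>\<^sub>1 \<in> cHML \<inter> eHML \<and>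
     (\<forall>(\<Gamma>, \<psi>) \<in> occs [] \<phi>\<^sub>1. can_verify \<Gamma> \<psi>)}"

datatype verdict = End | No | Yes

datatype parop = PAnd | POr

text \<open>\<open>Par PAnd\<close> and \<open>Par POr\<close> are the parallel compositions \<open>\<otimes>\<close> and \<open>\<oplus>\<close>.\<close>

datatype 'a mon =
    Verdict verdict
  | Pre 'a "'a mon"
  | Choice "'a mon" "'a mon"
  | Par parop "'a mon" "'a mon"
  | Rec var "'a mon"
  | MVar var

primrec mfv :: "'a mon \<Rightarrow> var set" where
  "mfv (Verdict v) = {}"
| "mfv (Pre a m) = mfv m"
| "mfv (Choice m n) = mfv m \<union> mfv n"
| "mfv (Par c m n) = mfv m \<union> mfv n"
| "mfv (Rec x m) = mfv m - {x}"
| "mfv (MVar x) = {x}"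

definition Mon :: "'a mon set" where
  "Mon = {m. mfv m = {}}"

text \<open>
  \<open>msubst p x m\<close> is \<open>m[p/x]\<close>. No renaming of bound variables is needed, since transitions
  of closed monitors only ever substitute closed monitors.
\<close>

primrec msubst :: "'a mon \<Rightarrow> var \<Rightarrow> 'a mon \<Rightarrow> 'a mon" where
  "msubst p x (Verdict v) = Verdict v"
| "msubst p x (Pre a m) = Pre a (msubst p x m)"
| "msubst p x (Choice m n) = Choice (msubst p x m) (msubst p x n)"
| "msubst p x (Par c m n) = Par c (msubst p x m) (msubst p x n)"
| "msubst p x (Rec y m) = (if y = x then Rec y m else Rec y (msubst p x m))"
| "msubst p x (MVar y) = (if y = x then p else MVar y)"

datatype 'a label = Tau | Vis 'a

inductive step :: "'a mon \<Rightarrow> 'a label \<Rightarrow> 'a mon \<Rightarrow> bool" where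
  "step (Pre a m) (Vis a) m"
| "step (Verdict v) (Vis a) (Verdict v)"
| "step (msubst (Rec x m) x m) (Vis a) n \<Longrightarrow> step (Rec x m) (Vis a) n"
| "step m (Vis a) m' \<Longrightarrow> step (Choice m n) (Vis a) m'"
| "step n (Vis a) n' \<Longrightarrow> step (Choice m n) (Vis a) n'"
| "step m (Vis a) m' \<Longrightarrow> step n (Vis a) n' \<Longrightarrow> step (Par c m n) (Vis a) (Par c m' n')"
| "step m Tau m' \<Longrightarrow> step (Par c m n) Tau (Par c m' n)"
| "step n Tau n' \<Longrightarrow> step (Par c m n) Tau (Par c m n')"
| "step (Par c (Verdict End) (Verdict End)) Tau (Verdict End)"
| "step (Par PAnd (Verdict Yes) m) Tau m"
| "step (Par PAnd m (Verdict Yes)) Tau m"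
| "step (Par PAnd (Verdict No) m) Tau (Verdict No)"
| "step (Par PAnd m (Verdict No)) Tau (Verdict No)"
| "step (Par POr (Verdict No) m) Tau m"
| "step (Par POr m (Verdict No)) Tau m"
| "step (Par POr (Verdict Yes) m) Tau (Verdict Yes)"
| "step (Par POr m (Verdict Yes)) Tau (Verdict Yes)"

inductive reaches :: "'a mon \<Rightarrow> 'a list \<Rightarrow> 'a mon \<Rightarrow> bool" where
  "reaches m [] m"
| "step m Tau m' \<Longrightarrow> reaches m' s n \<Longrightarrow> reaches m s n"
| "step m (Vis a) m' \<Longrightarrow> reaches m' s n \<Longrightarrow> reaches m (a # s) n"

fun accepts :: "'a mon \<Rightarrow> 'a trace \<Rightarrow> bool" where
  "accepts m (Fin s) \<longleftrightarrow> reaches m s (Verdict Yes)"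
| "accepts m (Inf t) \<longleftrightarrow> (\<exists>k. reaches m (stake k t) (Verdict Yes))"

fun rejects :: "'a mon \<Rightarrow> 'a trace \<Rightarrow> bool" where
  "rejects m (Fin s) \<longleftrightarrow> reaches m s (Verdict No)"
| "rejects m (Inf t) \<longleftrightarrow> (\<exists>k. reaches m (stake k t) (Verdict No))"

definition sound :: "'a mon \<Rightarrow> 'a trace set \<Rightarrow> bool" where
  "sound m P \<longleftrightarrow> (\<forall>f. (accepts m f \<longrightarrow> f \<in> P) \<and> (rejects m f \<longrightarrow> f \<notin> P))"

definition violation_persistently_informative :: "'a mon \<Rightarrow> bool" where
  "violation_persistently_informative m \<longleftrightarrow> (\<forall>s. \<exists>f. rejects m (tapp s f))"

definition satisfaction_persistently_informative :: "'a mon \<Rightarrow> bool" where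
  "satisfaction_persistently_informative m \<longleftrightarrow> (\<forall>s. \<exists>f. accepts m (tapp s f))"

end

theory Submission
  imports Defs
begin

text \<open>
  Call a trace property dense if every word extends to a bad prefix, that is, to a word whose
  residual is empty. A sound and violation-persistently informative monitor makes \<open>sem \<phi>\<close> dense,
  since rejection is irrevocable. For a formula all of whose subformulae can refute, explicitness
  lets one follow any word through the formula, and from the subformula reached some word leads
  to \<open>FF\<close>; so its semantics is dense as well, and so is that of any stronger formula.

  Conversely, a \<open>\<mu>HML\<close> formula has finitely many residuals, because they are Boolean
  combinations of the values of its subformulae. Unravelling the finite automaton of residuals,
  with the empty residual as \<open>FF\<close>, gives an explicit safety formula implied by \<open>\<phi>\<close>, and reading
  this formula as a monitor gives one that rejects exactly the bad prefixes. If \<open>sem \<phi>\<close> is dense,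
  every state has a path to the empty residual, so every subformula can refute and the monitor is
  persistently informative. The statement about satisfaction follows by dualising formulae and
  monitors.
\<close>

section \<open>Residuals\<close>

definition resid :: "'a list \<Rightarrow> 'a trace set \<Rightarrow> 'a trace set" where
  "resid s P = {f. tapp s f \<in> P}"

lemma tapp_append [simp]: "tapp (s @ t) f = tapp s (tapp t f)"
  by (cases f) auto

lemma tapp_Nil [simp]: "tapp [] f = f"
  by (cases f) auto

lemma tapp_inj [simp]: "tapp s f = tapp s g \<longleftrightarrow> f = g"
  by (cases f; cases g) (auto simp: shift_left_inj)

lemma tcons_inj [simp]: "tcons a f = tcons b g \<longleftrightarrow> a = b \<and> f = g"
  by (cases f; cases g) (auto simp: tcons_def)

lemma resid_Nil [simp]: "resid [] P = P"
  by (simp add: resid_def)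

lemma resid_append: "resid (s @ t) P = resid t (resid s P)"
  by (simp add: resid_def)

lemma resid_Cons: "resid (a # s) P = resid s (resid [a] P)"
  using resid_append[of "[a]" s P] by simp

lemma resid_empty [simp]: "resid s {} = {}"
  by (simp add: resid_def)

lemma resid_mono: "P \<subseteq> P' \<Longrightarrow> resid s P \<subseteq> resid s P'"
  by (auto simp: resid_def)

lemma mem_resid1: "f \<in> resid [a] P \<longleftrightarrow> tcons a f \<in> P"
  by (simp add: resid_def tcons_def)

definition dense :: "'a trace set \<Rightarrow> bool" where
  "dense P \<longleftrightarrow> (\<forall>s. \<exists>u. resid (s @ u) P = {})"

lemma dense_mono: "dense P' \<Longrightarrow> P \<subseteq> P' \<Longrightarrow> dense P"
  unfolding dense_def by (metis resid_mono subset_empty)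

section \<open>Monotonicity and fixpoint unfolding of the semantics\<close>

lemma eval_mono: "(\<And>X. \<rho> X \<subseteq> \<rho>' X) \<Longrightarrow> eval \<phi> \<rho> \<subseteq> eval \<phi> \<rho>'"
proof (induction \<phi> arbitrary: \<rho> \<rho>')
  case (FMin X \<phi>)
  have "eval \<phi> (\<rho>(X := S)) \<subseteq> eval \<phi> (\<rho>'(X := S))" for S
    using FMin.prems by (intro FMin.IH) simp
  then show ?case unfolding eval.simps by (rule lfp_mono)
next
  case (FMax X \<phi>)
  have "eval \<phi> (\<rho>(X := S)) \<subseteq> eval \<phi> (\<rho>'(X := S))" for S
    using FMax.prems by (intro FMax.IH) simp
  then show ?case unfolding eval.simps by (rule gfp_mono)
next
  case (Or \<phi> \<psi>)
  show ?case unfolding eval.simps by (intro Un_mono Or.IH Or.prems)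
next
  case (And \<phi> \<psi>)
  show ?case unfolding eval.simps by (intro Int_mono And.IH And.prems)
next
  case (Dia a \<phi>)
  have "eval \<phi> \<rho> \<subseteq> eval \<phi> \<rho>'" by (intro Dia.IH Dia.prems)
  then show ?case by auto
next
  case (Box a \<phi>)
  have "eval \<phi> \<rho> \<subseteq> eval \<phi> \<rho>'" by (intro Box.IH Box.prems)
  then show ?case by auto
qed simp_all

lemma mono_eval: "mono (\<lambda>S. eval \<phi> (\<rho>(X := S)))"
  by (rule monoI, rule eval_mono) simp

lemma eval_FMin_unfold: "eval \<phi> (\<rho>(X := eval (FMin X \<phi>) \<rho>)) = eval (FMin X \<phi>) \<rho>"
  using lfp_unfold[OF mono_eval[of \<phi> \<rho> X], symmetric] unfolding eval.simps .

lemma eval_FMax_unfold: "eval \<phi> (\<rho>(X := eval (FMax X \<phi>) \<rho>)) = eval (FMax X \<phi>) \<rho>"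
  using gfp_unfold[OF mono_eval[of \<phi> \<rho> X], symmetric] unfolding eval.simps .

text \<open>For finite \<open>G\<close> these are exactly the Boolean combinations of members of
  \<open>G\<close>. Phrasing this as invariance under lying in the same members of \<open>G\<close>
  avoids a syntax for such combinations.\<close>

definition determined :: "'b set set \<Rightarrow> 'b set \<Rightarrow> bool" where
  "determined G L \<longleftrightarrow> (\<forall>x y. (\<forall>g\<in>G. x \<in> g \<longleftrightarrow> y \<in> g) \<longrightarrow> (x \<in> L \<longleftrightarrow> y \<in> L))"

lemma determinedD:
  assumes "determined G L" "\<And>g. g \<in> G \<Longrightarrow> x \<in> g \<longleftrightarrow> y \<in> g"
  shows "x \<in> L \<longleftrightarrow> y \<in> L"
  by (rule assms(1)[unfolded determined_def, rule_format, OF assms(2)])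

lemma determinedI:
  assumes "\<And>x y. (\<And>g. g \<in> G \<Longrightarrow> x \<in> g \<longleftrightarrow> y \<in> g) \<Longrightarrow> x \<in> L \<longleftrightarrow> y \<in> L"
  shows "determined G L"
  unfolding determined_def
proof (intro allI impI)
  fix x y assume "\<forall>g\<in>G. x \<in> g \<longleftrightarrow> y \<in> g"
  then show "x \<in> L \<longleftrightarrow> y \<in> L" by (intro assms) (rule bspec)
qed

lemma determined_mono: "determined G L \<Longrightarrow> G \<subseteq> G' \<Longrightarrow> determined G' L"
  by (rule determinedI, erule determinedD) (metis subsetD)

lemma determined_base: "L \<in> G \<Longrightarrow> determined G L"
  by (rule determinedI)

lemma determined_const [simp]: "determined G UNIV" "determined G {}"
  by (auto intro: determinedI)

lemma determined_combine:
  assumes "determined G L" "determined G M"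
  shows "determined G (L \<union> M)" "determined G (L \<inter> M)"
proof -
  have *: "(x \<in> L \<longleftrightarrow> y \<in> L) \<and> (x \<in> M \<longleftrightarrow> y \<in> M)" if "\<And>g. g \<in> G \<Longrightarrow> x \<in> g \<longleftrightarrow> y \<in> g" for x y
    using determinedD[OF assms(1) that] determinedD[OF assms(2) that] by iprover
  show "determined G (L \<union> M)" "determined G (L \<inter> M)"
    by (rule determinedI; drule *; blast)+
qed

lemma determined_cut:
  assumes "determined (insert K G) L" "determined G K"
  shows "determined G L"
proof (rule determinedI)
  fix x y assume G: "\<And>g. g \<in> G \<Longrightarrow> x \<in> g \<longleftrightarrow> y \<in> g"
  then have "x \<in> K \<longleftrightarrow> y \<in> K" by (rule determinedD[OF assms(2)])
  with G show "x \<in> L \<longleftrightarrow> y \<in> L" by (intro determinedD[OF assms(1)]) auto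
qed

text \<open>Membership in a determined set depends only on the type of a point, the subset of
  \<open>G\<close> whose members contain it. Such a set is therefore given by a family of subsets of
  \<open>G\<close>, and there are finitely many of these.\<close>

lemma finite_determined:
  assumes "finite G"
  shows "finite {L. determined G L}"
proof (rule finite_subset)
  show "{L. determined G L} \<subseteq> (\<lambda>T. {x. {g\<in>G. x \<in> g} \<in> T}) ` Pow (Pow G)"
  proof
    fix L assume "L \<in> {L. determined G L}"
    then have L: "\<And>x y. {g\<in>G. x \<in> g} = {g\<in>G. y \<in> g} \<Longrightarrow> x \<in> L \<longleftrightarrow> y \<in> L"
      unfolding determined_def by blast
    have "L = {x. {g\<in>G. x \<in> g} \<in> (\<lambda>y. {g\<in>G. y \<in> g}) ` L}"
      using L by blast
    then show "L \<in> (\<lambda>T. {x. {g\<in>G. x \<in> g} \<in> T}) ` Pow (Pow G)"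
      by blast
  qed
qed (use assms in simp)

text \<open>Taking residuals is a preimage, so it commutes with Boolean combinations, and only the
  residuals of the generators have to be controlled.\<close>

lemma determined_resid:
  assumes "determined G L" "\<And>g. g \<in> G \<Longrightarrow> determined G (resid s g)"
  shows "determined G (resid s L)"
proof (rule determinedI)
  fix x y assume G: "\<And>g. g \<in> G \<Longrightarrow> x \<in> g \<longleftrightarrow> y \<in> g"
  have "tapp s x \<in> g \<longleftrightarrow> tapp s y \<in> g" if "g \<in> G" for g
    using determinedD[OF assms(2)[OF that] G] by (simp add: resid_def)
  then show "x \<in> resid s L \<longleftrightarrow> y \<in> resid s L"
    unfolding resid_def mem_Collect_eq by (rule determinedD[OF assms(1)])
qed

section \<open>Finiteness of the set of residuals\<close>

lemma unguarded_subset_fv: "unguarded \<phi> \<subseteq> fv \<phi>"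
  by (induction \<phi>) auto

definition deriv_system :: "'a trace set set \<Rightarrow> (var \<Rightarrow> 'a trace set) \<Rightarrow> var set \<Rightarrow> 'a trace set \<Rightarrow> bool" where
  "deriv_system G \<rho> V L \<longleftrightarrow> (\<forall>a. determined (G \<union> (\<lambda>Y. resid [a] (\<rho> Y)) ` V) (resid [a] L))"

lemma deriv_system_mono: "deriv_system G \<rho> V L \<Longrightarrow> G \<subseteq> G' \<Longrightarrow> V \<subseteq> V' \<Longrightarrow> deriv_system G' \<rho> V' L"
  unfolding deriv_system_def by (meson Un_mono determined_mono image_mono)

lemma deriv_system_Un:
  assumes "\<forall>L\<in>G. deriv_system G \<rho> V L" "\<forall>L\<in>H. deriv_system H \<rho> W L"
  shows "\<forall>L\<in>G \<union> H. deriv_system (G \<union> H) \<rho> (V \<union> W) L"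
  using assms by (blast intro: deriv_system_mono)

lemma deriv_system_insert:
  assumes "deriv_system (insert T G) \<rho> W T" "\<forall>L\<in>G. deriv_system G \<rho> V L" "W \<subseteq> V"
  shows "\<forall>L\<in>insert T G. deriv_system (insert T G) \<rho> V L"
  using assms by (blast intro: deriv_system_mono)

lemma deriv_system_combine:
  assumes "deriv_system G \<rho> V L" "deriv_system G \<rho> V M"
  shows "deriv_system G \<rho> V (L \<union> M)" "deriv_system G \<rho> V (L \<inter> M)"
proof -
  have "resid [a] (L \<union> M) = resid [a] L \<union> resid [a] M"
    "resid [a] (L \<inter> M) = resid [a] L \<inter> resid [a] M" for a
    by (auto simp: resid_def)
  then show "deriv_system G \<rho> V (L \<union> M)" "deriv_system G \<rho> V (L \<inter> M)"
    using assms unfolding deriv_system_def by (auto intro: determined_combine)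
qed

text \<open>\<open>S\<close> is the value of a fixpoint and also that of its variable
  \<open>X\<close>. Guardedness gives \<open>X \<notin> U\<close>, so the residuals of
  \<open>S\<close> are expressed without those of \<open>X\<close>. By \<open>determined_cut\<close>
  they can then be eliminated wherever the residual of \<open>X\<close> was a generator.\<close>

lemma deriv_system_fixpoint:
  assumes "deriv_system G (\<rho>(X := S)) U S" "X \<notin> U" "U \<subseteq> V"
    and L: "deriv_system G (\<rho>(X := S)) V L"
  shows "deriv_system G \<rho> U S" "deriv_system G \<rho> (V - {X}) L"
proof -
  have eq: "(\<lambda>Y. resid [a] ((\<rho>(X := S)) Y)) ` W = (\<lambda>Y. resid [a] (\<rho> Y)) ` W" if "X \<notin> W" for W a
    using that by (intro image_cong) auto
  show U: "deriv_system G \<rho> U S"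
    using assms(1) eq[OF assms(2)] unfolding deriv_system_def by simp
  show "deriv_system G \<rho> (V - {X}) L"
    unfolding deriv_system_def
  proof
    fix a
    let ?H = "G \<union> (\<lambda>Y. resid [a] (\<rho> Y)) ` (V - {X})"
    have "G \<union> (\<lambda>Y. resid [a] ((\<rho>(X := S)) Y)) ` V \<subseteq> insert (resid [a] S) ?H"
      by (auto split: if_splits)
    then have "determined (insert (resid [a] S) ?H) (resid [a] L)"
      using L determined_mono unfolding deriv_system_def by blast
    moreover have "determined ?H (resid [a] S)"
      using deriv_system_mono[OF U, of G "V - {X}"] assms(2,3) unfolding deriv_system_def by blast
    ultimately show "determined ?H (resid [a] L)"
      by (rule determined_cut)
  qed
qed

text \<open>
  A semantic version of the Fischer-Ladner closure: \<open>G\<close> collects the values of the subformulae,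
  and one-letter residuals are Boolean combinations of members of \<open>G\<close>, up to the residuals of
  the values of the variables.
\<close>

lemma ex_deriv_system:
  assumes "guarded \<phi>"
  shows "\<exists>G. finite G \<and> eval \<phi> \<rho> \<in> G \<and> (\<forall>L\<in>G. deriv_system G \<rho> (fv \<phi>) L) \<and>
    deriv_system G \<rho> (unguarded \<phi>) (eval \<phi> \<rho>)"
  using assms
proof (induction \<phi> arbitrary: \<rho>)
  case TT
  show ?case by (rule exI[of _ "{UNIV}"]) (auto simp: deriv_system_def resid_def)
next
  case FF
  show ?case by (rule exI[of _ "{{}}"]) (auto simp: deriv_system_def)
next
  case (Var X)
  show ?case by (rule exI[of _ "{\<rho> X}"]) (auto simp: deriv_system_def intro: determined_base)
next
  case (Or \<phi> \<psi>)
  then have g: "guarded \<phi>" "guarded \<psi>" by simp_all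
  obtain G where *: "finite G" "eval \<phi> \<rho> \<in> G" "\<forall>L\<in>G. deriv_system G \<rho> (fv \<phi>) L"
      "deriv_system G \<rho> (unguarded \<phi>) (eval \<phi> \<rho>)"
    using Or.IH(1)[OF g(1)] by blast
  obtain H where **: "finite H" "eval \<psi> \<rho> \<in> H" "\<forall>L\<in>H. deriv_system H \<rho> (fv \<psi>) L"
      "deriv_system H \<rho> (unguarded \<psi>) (eval \<psi> \<rho>)"
    using Or.IH(2)[OF g(2)] by blast
  let ?K = "insert (eval (Or \<phi> \<psi>) \<rho>) (G \<union> H)"
  have top: "deriv_system ?K \<rho> (unguarded (Or \<phi> \<psi>)) (eval (Or \<phi> \<psi>) \<rho>)"
    unfolding eval.simps
    by (intro deriv_system_combine deriv_system_mono[OF *(4)] deriv_system_mono[OF **(4)]) auto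
  have "\<forall>L\<in>?K. deriv_system ?K \<rho> (fv (Or \<phi> \<psi>)) L"
    using deriv_system_insert[OF top deriv_system_Un[OF *(3) **(3)]] unguarded_subset_fv[of "Or \<phi> \<psi>"]
    by simp
  with top *(1) **(1) show ?case by (intro exI[of _ ?K]) (simp del: eval.simps)
next
  case (And \<phi> \<psi>)
  then have g: "guarded \<phi>" "guarded \<psi>" by simp_all
  obtain G where *: "finite G" "eval \<phi> \<rho> \<in> G" "\<forall>L\<in>G. deriv_system G \<rho> (fv \<phi>) L"
      "deriv_system G \<rho> (unguarded \<phi>) (eval \<phi> \<rho>)"
    using And.IH(1)[OF g(1)] by blast
  obtain H where **: "finite H" "eval \<psi> \<rho> \<in> H" "\<forall>L\<in>H. deriv_system H \<rho> (fv \<psi>) L"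
      "deriv_system H \<rho> (unguarded \<psi>) (eval \<psi> \<rho>)"
    using And.IH(2)[OF g(2)] by blast
  let ?K = "insert (eval (And \<phi> \<psi>) \<rho>) (G \<union> H)"
  have top: "deriv_system ?K \<rho> (unguarded (And \<phi> \<psi>)) (eval (And \<phi> \<psi>) \<rho>)"
    unfolding eval.simps
    by (intro deriv_system_combine deriv_system_mono[OF *(4)] deriv_system_mono[OF **(4)]) auto
  have "\<forall>L\<in>?K. deriv_system ?K \<rho> (fv (And \<phi> \<psi>)) L"
    using deriv_system_insert[OF top deriv_system_Un[OF *(3) **(3)]] unguarded_subset_fv[of "And \<phi> \<psi>"]
    by simp
  with top *(1) **(1) show ?case by (intro exI[of _ ?K]) (simp del: eval.simps)
next
  case (Dia a \<phi>)
  then have g: "guarded \<phi>" by simp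
  obtain G where *: "finite G" "eval \<phi> \<rho> \<in> G" "\<forall>L\<in>G. deriv_system G \<rho> (fv \<phi>) L"
    using Dia.IH[OF g] by blast
  let ?K = "insert (eval (Dia a \<phi>) \<rho>) G"
  have "resid [b] (eval (Dia a \<phi>) \<rho>) = (if a = b then eval \<phi> \<rho> else {})" for b
    by (auto simp: mem_resid1)
  \<comment> \<open>The modality consumes the letter, so no variable contributes its residual here:
    this is why the variable set is empty.\<close>
  then have top: "deriv_system ?K \<rho> {} (eval (Dia a \<phi>) \<rho>)"
    using *(2) by (auto simp: deriv_system_def intro: determined_base)
  have "\<forall>L\<in>?K. deriv_system ?K \<rho> (fv (Dia a \<phi>)) L"
    using deriv_system_insert[OF top *(3)] by simp
  with top *(1) show ?case by (intro exI[of _ ?K]) (simp del: eval.simps)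
next
  case (Box a \<phi>)
  then have g: "guarded \<phi>" by simp
  obtain G where *: "finite G" "eval \<phi> \<rho> \<in> G" "\<forall>L\<in>G. deriv_system G \<rho> (fv \<phi>) L"
    using Box.IH[OF g] by blast
  let ?K = "insert (eval (Box a \<phi>) \<rho>) G"
  have "resid [b] (eval (Box a \<phi>) \<rho>) = (if a = b then eval \<phi> \<rho> else UNIV)" for b
    by (auto simp: mem_resid1)
  then have top: "deriv_system ?K \<rho> {} (eval (Box a \<phi>) \<rho>)"
    using *(2) by (auto simp: deriv_system_def intro: determined_base)
  have "\<forall>L\<in>?K. deriv_system ?K \<rho> (fv (Box a \<phi>)) L"
    using deriv_system_insert[OF top *(3)] by simp
  with top *(1) show ?case by (intro exI[of _ ?K]) (simp del: eval.simps)
next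
  case (FMin X \<phi>)
  then have g: "guarded \<phi>" and X: "X \<notin> unguarded \<phi>" by simp_all
  let ?S = "eval (FMin X \<phi>) \<rho>"
  \<comment> \<open>By unfolding, the body has the value \<open>?S\<close> again when
    \<open>X\<close> is set to \<open>?S\<close>, so the system of the body serves the fixpoint as
    well.\<close>
  obtain G where *: "finite G" "?S \<in> G" "\<forall>L\<in>G. deriv_system G (\<rho>(X := ?S)) (fv \<phi>) L"
      "deriv_system G (\<rho>(X := ?S)) (unguarded \<phi>) ?S"
    using FMin.IH[OF g, of "\<rho>(X := ?S)"] unfolding eval_FMin_unfold by blast
  note fp = deriv_system_fixpoint[OF *(4) X unguarded_subset_fv]
  note top = fp(1)[OF bspec[OF *(3,2)]]
  show ?case
    using *(1-3) X top fp(2) by (intro exI[of _ G]) (simp del: eval.simps)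
next
  case (FMax X \<phi>)
  then have g: "guarded \<phi>" and X: "X \<notin> unguarded \<phi>" by simp_all
  let ?S = "eval (FMax X \<phi>) \<rho>"
  obtain G where *: "finite G" "?S \<in> G" "\<forall>L\<in>G. deriv_system G (\<rho>(X := ?S)) (fv \<phi>) L"
      "deriv_system G (\<rho>(X := ?S)) (unguarded \<phi>) ?S"
    using FMax.IH[OF g, of "\<rho>(X := ?S)"] unfolding eval_FMax_unfold by blast
  note fp = deriv_system_fixpoint[OF *(4) X unguarded_subset_fv]
  note top = fp(1)[OF bspec[OF *(3,2)]]
  show ?case
    using *(1-3) X top fp(2) by (intro exI[of _ G]) (simp del: eval.simps)
qed

lemma finite_residuals:
  assumes "\<phi> \<in> muHML"
  shows "finite (range (\<lambda>s. resid s (sem \<phi>)))"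
proof -
  obtain G where G: "finite G" "sem \<phi> \<in> G" "\<forall>L\<in>G. deriv_system G (\<lambda>_. {}) {} L"
    using ex_deriv_system[of \<phi> "\<lambda>_. {}"] assms by (auto simp: muHML_def sem_def)
  \<comment> \<open>The formula is closed, so no residuals of variables are left, and the sets
    determined by \<open>G\<close> are closed under residuals.\<close>
  have step: "determined G (resid [a] L)" if "determined G L" for a L
    using determined_resid[OF that] G(3) by (simp add: deriv_system_def)
  have "determined G (resid s L)" if "determined G L" for s L
    using that
  proof (induction s arbitrary: L)
    case (Cons a s)
    then show ?case using step by (subst resid_Cons) blast
  qed simp
  then show ?thesis
    using finite_determined[OF G(1)] determined_base[OF G(2)]
    by (elim finite_subset[rotated]) auto
qed

section \<open>Formulae that can refute\<close>

text \<open>Density is this property for every residual of \<open>P\<close>.\<close>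

definition refutable :: "'a trace set \<Rightarrow> bool" where
  "refutable P \<longleftrightarrow> (\<exists>u. resid u P = {})"

lemma refutable_empty [simp]: "refutable {}"
  by (auto simp: refutable_def)

lemma refutable_subset: "refutable P' \<Longrightarrow> P \<subseteq> P' \<Longrightarrow> refutable P"
  unfolding refutable_def by (metis resid_mono subset_empty)

lemma refutable_Cons: "refutable (resid [a] P) \<Longrightarrow> refutable P"
  unfolding refutable_def by (metis resid_append)

lemma resid_Box: "resid [a] (eval (Box a \<phi>) \<rho>) = eval \<phi> \<rho>"
  by (auto simp: mem_resid1)

text \<open>Only used for contexts of sHML formulae, where every binder is a maximal fixpoint.\<close>

primrec ctx_val :: "'a fm list \<Rightarrow> var \<Rightarrow> 'a trace set" where
  "ctx_val [] = (\<lambda>_. {})"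
| "ctx_val (\<theta> # \<Gamma>) =
    (case \<theta> of FMax X \<chi> \<Rightarrow> (ctx_val \<Gamma>)(X := eval \<theta> (ctx_val \<Gamma>)) | _ \<Rightarrow> ctx_val \<Gamma>)"

lemma ctx_val_append:
  "(\<And>\<theta>. \<theta> \<in> set \<Delta> \<Longrightarrow> \<not> binds X \<theta>) \<Longrightarrow> ctx_val (\<Delta> @ \<Gamma>) X = ctx_val \<Gamma> X"
proof (induction \<Delta>)
  case (Cons \<theta> \<Delta>)
  then have "ctx_val (\<Delta> @ \<Gamma>) X = ctx_val \<Gamma> X" "\<not> binds X \<theta>" by simp_all
  then show ?case by (auto simp: binds_def split: fm.split)
qed simp

lemma ctx_val_lookup:
  assumes "\<forall>\<theta>\<in>set \<Gamma>\<^sub>1. \<not> binds X \<theta>"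
  shows "ctx_val (\<Gamma>\<^sub>1 @ FMax X \<chi> # \<Gamma>\<^sub>2) X = eval (FMax X \<chi>) (ctx_val \<Gamma>\<^sub>2)"
  using assms by (subst ctx_val_append) auto

text \<open>The fixpoint equation, in the form that lets one move from a fixpoint to its body while
  extending the context.\<close>

lemma eval_FMax_ctx_val: "eval \<chi> (ctx_val (FMax X \<chi> # \<Gamma>)) = eval (FMax X \<chi>) (ctx_val \<Gamma>)"
  using eval_FMax_unfold[of \<chi> "ctx_val \<Gamma>" X] by (simp del: eval.simps)

section \<open>Occurrences and the binders of their variables\<close>

lemma occs_self: "(\<Gamma>, \<psi>) \<in> occs \<Gamma> \<psi>"
  by (cases \<psi>) auto

lemma occs_trans: "(\<Delta>, \<chi>) \<in> occs \<Gamma> \<psi> \<Longrightarrow> occs \<Delta> \<chi> \<subseteq> occs \<Gamma> \<psi>"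
  by (induction \<Gamma> \<psi> rule: occs.induct) auto

lemma occs_append_ctx: "(\<Delta>, \<chi>) \<in> occs \<Gamma> \<psi> \<Longrightarrow> (\<Delta> @ \<Gamma>', \<chi>) \<in> occs (\<Gamma> @ \<Gamma>') \<psi>"
  by (induction \<Gamma> \<psi> rule: occs.induct) auto

lemma occurs_in_occs: "occurs_in \<chi> \<psi> \<Longrightarrow> \<exists>\<Delta>. (\<Delta>, \<chi>) \<in> occs \<Gamma> \<psi>"
  unfolding occurs_in_def using occs_append_ctx[of _ \<chi> "[]" \<psi> \<Gamma>] by auto

lemma fv_occs: "X \<in> fv \<psi> \<Longrightarrow> \<exists>\<Delta>. (\<Delta> @ \<Gamma>, Var X) \<in> occs \<Gamma> \<psi> \<and> (\<forall>\<theta>\<in>set \<Delta>. \<not> binds X \<theta>)"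
proof (induction \<psi> arbitrary: \<Gamma>)
  case (FMin Y \<psi>)
  then have "X \<in> fv \<psi>" "X \<noteq> Y" by auto
  moreover obtain \<Delta> where "(\<Delta> @ FMin Y \<psi> # \<Gamma>, Var X) \<in> occs (FMin Y \<psi> # \<Gamma>) \<psi>"
    "\<forall>\<theta>\<in>set \<Delta>. \<not> binds X \<theta>"
    using FMin.IH[OF calculation(1)] by blast
  ultimately show ?case by (intro exI[of _ "\<Delta> @ [FMin Y \<psi>]"]) (auto simp: binds_def)
next
  case (FMax Y \<psi>)
  then have "X \<in> fv \<psi>" "X \<noteq> Y" by auto
  moreover obtain \<Delta> where "(\<Delta> @ FMax Y \<psi> # \<Gamma>, Var X) \<in> occs (FMax Y \<psi> # \<Gamma>) \<psi>"
    "\<forall>\<theta>\<in>set \<Delta>. \<not> binds X \<theta>"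
    using FMax.IH[OF calculation(1)] by blast
  ultimately show ?case by (intro exI[of _ "\<Delta> @ [FMax Y \<psi>]"]) (auto simp: binds_def)
qed (simp; blast)+

text \<open>The innermost binder of \<open>X\<close> is recorded with its own context
  \<open>\<Gamma>\<^sub>2\<close> as a member of \<open>O'\<close>, in use the set of all
  occurrences of a root formula. Whatever is known of occurrences then applies to the binder
  too.\<close>

definition bound_in_scope :: "var \<Rightarrow> 'a fm list \<Rightarrow> ('a fm list \<times> 'a fm) set \<Rightarrow> bool" where
  "bound_in_scope X \<Delta> O' \<longleftrightarrow> (\<exists>\<Gamma>\<^sub>1 \<theta> \<Gamma>\<^sub>2. \<Delta> = \<Gamma>\<^sub>1 @ \<theta> # \<Gamma>\<^sub>2 \<and> binds X \<theta> \<and>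
    (\<forall>\<theta>'\<in>set \<Gamma>\<^sub>1. \<not> binds X \<theta>') \<and> (\<Gamma>\<^sub>2, \<theta>) \<in> O')"

lemma bound_in_scope_mono: "bound_in_scope X \<Delta> O' \<Longrightarrow> O' \<subseteq> O'' \<Longrightarrow> bound_in_scope X \<Delta> O''"
  unfolding bound_in_scope_def by blast

definition unbound_between :: "var \<Rightarrow> 'a fm list \<Rightarrow> 'a fm list \<Rightarrow> bool" where
  "unbound_between X \<Delta> \<Gamma> \<longleftrightarrow> (\<exists>\<Gamma>\<^sub>1. \<Delta> = \<Gamma>\<^sub>1 @ \<Gamma> \<and> (\<forall>\<theta>\<in>set \<Gamma>\<^sub>1. \<not> binds X \<theta>))"

lemma unbound_refl: "unbound_between X \<Gamma> \<Gamma>"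
  by (simp add: unbound_between_def)

lemma unbound_between_tl:
  assumes "unbound_between X \<Delta> (\<theta> # \<Gamma>)" "\<not> binds X \<theta>"
  shows "unbound_between X \<Delta> \<Gamma>"
proof -
  obtain \<Gamma>\<^sub>1 where "\<Delta> = \<Gamma>\<^sub>1 @ \<theta> # \<Gamma>" "\<forall>\<theta>\<in>set \<Gamma>\<^sub>1. \<not> binds X \<theta>"
    using assms(1) unfolding unbound_between_def by blast
  then show ?thesis
    unfolding unbound_between_def using assms(2) by (intro exI[of _ "\<Gamma>\<^sub>1 @ [\<theta>]"]) auto
qed

lemma bound_in_scopeI:
  "unbound_between X \<Delta> (\<theta> # \<Gamma>) \<Longrightarrow> binds X \<theta> \<Longrightarrow> (\<Gamma>, \<theta>) \<in> O' \<Longrightarrow> bound_in_scope X \<Delta> O'"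
  unfolding bound_in_scope_def unbound_between_def by blast

lemma bound_in_scope_insert: "bound_in_scope X \<Delta> O' \<Longrightarrow> bound_in_scope X \<Delta> (insert z O')"
  by (rule bound_in_scope_mono) auto

lemma bound_in_scope_Un:
  "bound_in_scope X \<Delta> O' \<Longrightarrow> bound_in_scope X \<Delta> (O' \<union> O'')"
  "bound_in_scope X \<Delta> O'' \<Longrightarrow> bound_in_scope X \<Delta> (O' \<union> O'')"
  by (auto elim: bound_in_scope_mono)

text \<open>Going outwards from the occurrence, each fixpoint either catches \<open>X\<close> or
  lets it pass. For a closed root the first alternative is impossible, so every free variable of an
  occurrence leads to a binder that is itself an occurrence.\<close>

lemma occs_binder_cases:
  assumes "(\<Delta>, \<chi>) \<in> occs \<Gamma> \<psi>" "X \<in> fv \<chi>"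
  shows "(X \<in> fv \<psi> \<and> unbound_between X \<Delta> \<Gamma>) \<or> bound_in_scope X \<Delta> (occs \<Gamma> \<psi>)"
  using assms(1)
proof (induction \<Gamma> \<psi> rule: occs.induct)
  case (5 \<Gamma> Y \<phi>)
  let ?\<theta> = "FMin Y \<phi>"
  have mono: "occs (?\<theta> # \<Gamma>) \<phi> \<subseteq> occs \<Gamma> ?\<theta>" by auto
  show ?case
  proof (cases "(\<Delta>, \<chi>) = (\<Gamma>, ?\<theta>)")
    case True
    then have "X \<in> fv ?\<theta>" "\<Delta> = \<Gamma>" using assms(2) by auto
    then show ?thesis using unbound_refl by blast
  next
    case False
    with 5(2) have "(\<Delta>, \<chi>) \<in> occs (?\<theta> # \<Gamma>) \<phi>" by auto
    from 5(1)[OF this] show ?thesis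
    proof
      assume *: "X \<in> fv \<phi> \<and> unbound_between X \<Delta> (?\<theta> # \<Gamma>)"
      show ?thesis
      proof (cases "X = Y")
        case True
        then have "bound_in_scope X \<Delta> (occs \<Gamma> ?\<theta>)"
          using * occs_self[of \<Gamma> ?\<theta>] by (intro bound_in_scopeI[of X \<Delta> ?\<theta> \<Gamma>]) (auto simp: binds_def)
        then show ?thesis ..
      next
        case False
        then have "\<not> binds X ?\<theta>" by (simp add: binds_def)
        with * False show ?thesis using unbound_between_tl[of X \<Delta> ?\<theta> \<Gamma>] by simp
      qed
    qed (use bound_in_scope_mono[OF _ mono] in blast)
  qed
next
  case (6 \<Gamma> Y \<phi>)
  let ?\<theta> = "FMax Y \<phi>"
  have mono: "occs (?\<theta> # \<Gamma>) \<phi> \<subseteq> occs \<Gamma> ?\<theta>" by auto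
  show ?case
  proof (cases "(\<Delta>, \<chi>) = (\<Gamma>, ?\<theta>)")
    case True
    then have "X \<in> fv ?\<theta>" "\<Delta> = \<Gamma>" using assms(2) by auto
    then show ?thesis using unbound_refl by blast
  next
    case False
    with 6(2) have "(\<Delta>, \<chi>) \<in> occs (?\<theta> # \<Gamma>) \<phi>" by auto
    from 6(1)[OF this] show ?thesis
    proof
      assume *: "X \<in> fv \<phi> \<and> unbound_between X \<Delta> (?\<theta> # \<Gamma>)"
      show ?thesis
      proof (cases "X = Y")
        case True
        then have "bound_in_scope X \<Delta> (occs \<Gamma> ?\<theta>)"
          using * occs_self[of \<Gamma> ?\<theta>] by (intro bound_in_scopeI[of X \<Delta> ?\<theta> \<Gamma>]) (auto simp: binds_def)
        then show ?thesis ..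
      next
        case False
        then have "\<not> binds X ?\<theta>" by (simp add: binds_def)
        with * False show ?thesis using unbound_between_tl[of X \<Delta> ?\<theta> \<Gamma>] by simp
      qed
    qed (use bound_in_scope_mono[OF _ mono] in blast)
  qed
qed (use assms(2) in \<open>auto simp: unbound_refl intro: bound_in_scope_insert bound_in_scope_Un\<close>)

section \<open>Refutability in sHML\<close>

inductive_cases sHML_elims:
  "Box a \<phi> \<in> sHML" "And \<phi> \<psi> \<in> sHML" "FMax X \<phi> \<in> sHML"
  "Or \<phi> \<psi> \<in> sHML" "Dia a \<phi> \<in> sHML" "FMin X \<phi> \<in> sHML"

lemma sHML_simps [simp]:
  "TT \<in> sHML" "FF \<in> sHML" "Var X \<in> sHML"
  "Box a \<phi> \<in> sHML \<longleftrightarrow> \<phi> \<in> sHML" "And \<phi> \<psi> \<in> sHML \<longleftrightarrow> \<phi> \<in> sHML \<and> \<psi> \<in> sHML"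
  "FMax X \<phi> \<in> sHML \<longleftrightarrow> \<phi> \<in> sHML"
  "Or \<phi> \<psi> \<notin> sHML" "Dia a \<phi> \<notin> sHML" "FMin X \<phi> \<notin> sHML"
  by (blast intro: sHML.intros elim: sHML_elims)+

lemma sHML_occs: "(\<Delta>, \<chi>) \<in> occs \<Gamma> \<psi> \<Longrightarrow> \<psi> \<in> sHML \<Longrightarrow> \<chi> \<in> sHML"
  by (induction \<Gamma> \<psi> rule: occs.induct) auto

lemma sHML_ctx: "(\<Delta>, \<chi>) \<in> occs \<Gamma> \<psi> \<Longrightarrow> \<psi> \<in> sHML \<Longrightarrow> set \<Gamma> \<subseteq> sHML \<Longrightarrow> set \<Delta> \<subseteq> sHML"
  by (induction \<Gamma> \<psi> rule: occs.induct) auto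

lemma guarded_occs: "(\<Delta>, \<chi>) \<in> occs \<Gamma> \<psi> \<Longrightarrow> guarded \<psi> \<Longrightarrow> guarded \<chi>"
  by (induction \<Gamma> \<psi> rule: occs.induct) auto

text \<open>Refutability moves outwards: a conjunction is contained in its conjuncts, a box prepends
  its action to the bad prefix, and a maximal fixpoint has the value of its body in the extended
  context.\<close>

lemma refutable_occs:
  assumes "(\<Delta>, \<chi>) \<in> occs \<Gamma> \<psi>" "\<psi> \<in> sHML" "refutable (eval \<chi> (ctx_val \<Delta>))"
  shows "refutable (eval \<psi> (ctx_val \<Gamma>))"
  using assms(1,2)
proof (induction \<Gamma> \<psi> rule: occs.induct)
  case (2 \<Gamma> \<phi> \<psi>)
  then show ?case using assms(3) by (auto elim: refutable_subset)
next
  case (4 \<Gamma> a \<phi>)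
  then have "(\<Delta>, \<chi>) = (\<Gamma>, Box a \<phi>) \<or> refutable (eval \<phi> (ctx_val \<Gamma>))" by auto
  then show ?case using assms(3) refutable_Cons[of a "eval (Box a \<phi>) (ctx_val \<Gamma>)"]
    unfolding resid_Box by blast
next
  case (6 \<Gamma> X \<phi>)
  then have "(\<Delta>, \<chi>) = (\<Gamma>, FMax X \<phi>) \<or> refutable (eval \<phi> (ctx_val (FMax X \<phi> # \<Gamma>)))"
    by (auto simp del: ctx_val.simps)
  then show ?case using assms(3) unfolding eval_FMax_ctx_val by blast
qed (use assms(3) in simp_all)

text \<open>An occurrence of \<open>FF\<close> has the empty value. A variable has the value of its
  binder, which is refutable by induction on the number of unfoldings. In both cases
  \<open>refutable_occs\<close> carries refutability outwards to \<open>\<psi>\<close>.\<close>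

lemma refutable_if_can_refute_in:
  "can_refute_in k \<Gamma> \<psi> \<Longrightarrow> \<psi> \<in> sHML \<Longrightarrow> set \<Gamma> \<subseteq> sHML \<Longrightarrow> refutable (eval \<psi> (ctx_val \<Gamma>))"
proof (induction k arbitrary: \<Gamma> \<psi>)
  case 0
  then obtain \<Delta> where "(\<Delta>, FF) \<in> occs \<Gamma> \<psi>" using occurs_in_occs[of FF \<psi> \<Gamma>] by auto
  then show ?case using refutable_occs 0 by fastforce
next
  case (Suc k)
  from Suc.prems(1)[unfolded can_refute_in.simps] show ?case
  proof (elim disjE exE conjE)
    assume "can_refute_in k \<Gamma> \<psi>"
    then show ?thesis using Suc by blast
  next
    fix X \<chi> \<Gamma>\<^sub>1 \<Gamma>\<^sub>2
    assume *: "X \<in> fv \<psi>" "\<Gamma> = \<Gamma>\<^sub>1 @ FMax X \<chi> # \<Gamma>\<^sub>2" "\<forall>\<theta>\<in>set \<Gamma>\<^sub>1. \<not> binds X \<theta>"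
      "can_refute_in k \<Gamma>\<^sub>2 (FMax X \<chi>)"
    obtain \<Delta> where \<Delta>: "(\<Delta> @ \<Gamma>, Var X) \<in> occs \<Gamma> \<psi>" "\<forall>\<theta>\<in>set \<Delta>. \<not> binds X \<theta>"
      using fv_occs[OF *(1)] by blast
    have "eval (Var X) (ctx_val (\<Delta> @ \<Gamma>)) = eval (FMax X \<chi>) (ctx_val \<Gamma>\<^sub>2)"
      using ctx_val_lookup[of "\<Delta> @ \<Gamma>\<^sub>1" X \<chi> \<Gamma>\<^sub>2] *(2,3) \<Delta>(2) by auto
    moreover have "refutable (eval (FMax X \<chi>) (ctx_val \<Gamma>\<^sub>2))"
      using Suc.IH[OF *(4)] Suc.prems(3) *(2) by (auto simp del: eval.simps)
    ultimately show ?thesis using refutable_occs[OF \<Delta>(1) Suc.prems(2)] by simp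
  qed
qed

section \<open>Reading a letter in an explicit formula\<close>

lemma big_box_occs:
  "big_box A F \<chi> \<Longrightarrow> (\<Delta>, \<xi>) \<in> occs \<Gamma> \<chi> \<Longrightarrow>
    (\<exists>a\<in>A. (\<Delta>, \<xi>) \<in> occs \<Gamma> (F a)) \<or> (\<exists>b \<eta>. \<xi> = Box b \<eta>) \<or> (\<exists>\<eta> \<eta>'. \<xi> = And \<eta> \<eta>')"
  by (induction rule: big_box.induct) auto

lemma big_dia_occs:
  "big_dia A F \<chi> \<Longrightarrow> (\<Delta>, \<xi>) \<in> occs \<Gamma> \<chi> \<Longrightarrow>
    (\<exists>a\<in>A. (\<Delta>, \<xi>) \<in> occs \<Gamma> (F a)) \<or> (\<exists>b \<eta>. \<xi> = Dia b \<eta>) \<or> (\<exists>\<eta> \<eta>'. \<xi> = Or \<eta> \<eta>')"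
  by (induction rule: big_dia.induct) auto

text \<open>\<open>eHML\<close> is not closed under subformulae, since a part of a conjunction over
  all actions need not be explicit. But the connectives and modalities that make up such a
  conjunction or disjunction are never fixpoints, so a maximal fixpoint is always explicit.\<close>

lemma FMax_occs_eHML:
  assumes "\<psi> \<in> eHML" "(\<Delta>, FMax X \<chi>) \<in> occs \<Gamma> \<psi>"
  shows "FMax X \<chi> \<in> eHML"
  using assms
proof (induction arbitrary: \<Gamma> rule: eHML.induct)
  case (8 F \<psi>)
  then show ?case using big_dia_occs[OF 8(2,4)] by auto
next
  case (9 F \<psi>)
  then show ?case using big_box_occs[OF 9(2,4)] by auto
qed (auto intro: eHML.intros)

lemma big_box_at:
  "big_box A F \<chi> \<Longrightarrow> a \<in> A \<Longrightarrow> (\<Gamma>, F a) \<in> occs \<Gamma> \<chi> \<and> resid [a] (eval \<chi> \<rho>) \<subseteq> eval (F a) \<rho>"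
proof (induction rule: big_box.induct)
  case (2 A F \<chi> B \<chi>')
  have "resid [a] (eval (And \<chi> \<chi>') \<rho>) \<subseteq> resid [a] (eval \<chi> \<rho>) \<inter> resid [a] (eval \<chi>' \<rho>)"
    by (auto simp: resid_def)
  with 2 show ?case by auto
qed (auto simp: occs_self mem_resid1)

lemma big_dia_not_sHML: "big_dia A F \<chi> \<Longrightarrow> \<chi> \<notin> sHML"
  by (cases rule: big_dia.cases) auto

text \<open>Reading \<open>a\<close> passes through fixpoints by unfolding and through the left side
  of a plain conjunction, which is enough for an upper bound, and takes the \<open>a\<close>-branch
  of a conjunction over all actions. The second alternative arises when a variable is met before any
  modality.\<close>

lemma eHML_step:
  assumes "\<psi> \<in> eHML" "\<psi> \<in> sHML" "guarded \<psi>" "\<And>\<Delta>. (\<Delta>, TT) \<notin> occs \<Gamma> \<psi>"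
  shows "(\<exists>(\<Delta>, \<chi>) \<in> occs \<Gamma> \<psi>. \<chi> \<in> eHML \<and> resid [a] (eval \<psi> (ctx_val \<Gamma>)) \<subseteq> eval \<chi> (ctx_val \<Delta>)) \<or>
    (\<exists>X\<in>unguarded \<psi>. eval \<psi> (ctx_val \<Gamma>) \<subseteq> ctx_val \<Gamma> X)"
  using assms
proof (induction arbitrary: \<Gamma> rule: eHML.induct)
  case (4 \<phi> X)
  have "(\<exists>(\<Delta>, \<chi>) \<in> occs (FMax X \<phi> # \<Gamma>) \<phi>. \<chi> \<in> eHML \<and>
      resid [a] (eval (FMax X \<phi>) (ctx_val \<Gamma>)) \<subseteq> eval \<chi> (ctx_val \<Delta>)) \<or>
    (\<exists>Y\<in>unguarded \<phi>. eval (FMax X \<phi>) (ctx_val \<Gamma>) \<subseteq> ctx_val (FMax X \<phi> # \<Gamma>) Y)"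
    using 4(2)[of "FMax X \<phi> # \<Gamma>"] 4(3-5) unfolding eval_FMax_ctx_val by (simp del: eval.simps)
  then show ?case
  proof
    assume "\<exists>Y\<in>unguarded \<phi>. eval (FMax X \<phi>) (ctx_val \<Gamma>) \<subseteq> ctx_val (FMax X \<phi> # \<Gamma>) Y"
    then obtain Y where "Y \<in> unguarded \<phi>" "eval (FMax X \<phi>) (ctx_val \<Gamma>) \<subseteq> ctx_val (FMax X \<phi> # \<Gamma>) Y"
      by blast
    \<comment> \<open>Guardedness excludes \<open>X\<close>, so the variable reached belongs outside
      this fixpoint and its value is not affected by the new context entry.\<close>
    moreover have "X \<notin> unguarded \<phi>" using 4(4) by simp
    ultimately show ?thesis by (intro disjI2 bexI[of _ Y]) (auto simp del: eval.simps split: if_splits)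
  next
    assume "\<exists>(\<Delta>, \<chi>) \<in> occs (FMax X \<phi> # \<Gamma>) \<phi>. \<chi> \<in> eHML \<and>
      resid [a] (eval (FMax X \<phi>) (ctx_val \<Gamma>)) \<subseteq> eval \<chi> (ctx_val \<Delta>)"
    then show ?thesis unfolding occs.simps by blast
  qed
next
  case (7 \<phi> \<psi>)
  have "resid [a] (eval (And \<phi> \<psi>) (ctx_val \<Gamma>)) \<subseteq> resid [a] (eval \<phi> (ctx_val \<Gamma>))"
    "eval (And \<phi> \<psi>) (ctx_val \<Gamma>) \<subseteq> eval \<phi> (ctx_val \<Gamma>)"
    by (auto simp: resid_def)
  moreover have "occs \<Gamma> \<phi> \<subseteq> occs \<Gamma> (And \<phi> \<psi>)" "unguarded \<phi> \<subseteq> unguarded (And \<phi> \<psi>)" by auto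
  moreover have "(\<exists>(\<Delta>, \<chi>)\<in>occs \<Gamma> \<phi>. \<chi> \<in> eHML \<and> resid [a] (eval \<phi> (ctx_val \<Gamma>)) \<subseteq> eval \<chi> (ctx_val \<Delta>)) \<or>
      (\<exists>X\<in>unguarded \<phi>. eval \<phi> (ctx_val \<Gamma>) \<subseteq> ctx_val \<Gamma> X)"
    using 7(5-7) by (intro 7(3)) auto
  ultimately show ?case by blast
next
  case (8 F \<chi>)
  then show ?case using big_dia_not_sHML by blast
next
  case (9 F \<chi>)
  then show ?case using big_box_at[OF 9(2), of a] by blast
qed (auto intro: eHML.intros)

lemma dense_if_can_refute:
  assumes "fv \<phi> = {}" "guarded \<phi>" "\<phi> \<in> sHML" "\<phi> \<in> eHML"
    and ref: "\<forall>(\<Gamma>, \<psi>) \<in> occs [] \<phi>. can_refute \<Gamma> \<psi>"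
  shows "dense (sem \<phi>)"
proof -
  have no_TT: "(\<Gamma>, TT) \<notin> occs [] \<phi>" for \<Gamma>
  proof
    \<comment> \<open>\<open>TT\<close> contains neither \<open>FF\<close> nor a variable, so no
      number of unfoldings helps.\<close>
    have "\<not> can_refute_in k \<Gamma> TT" for k
      by (induction k) (auto simp: occurs_in_def)
    moreover assume "(\<Gamma>, TT) \<in> occs [] \<phi>"
    ultimately show False using ref unfolding can_refute_def by blast
  qed
  have scope: "bound_in_scope X \<Gamma> (occs [] \<phi>)" if "(\<Gamma>, \<psi>) \<in> occs [] \<phi>" "X \<in> fv \<psi>" for \<Gamma> \<psi> X
    using occs_binder_cases[OF that] assms(1) by simp
  have step: "\<exists>(\<Delta>, \<chi>) \<in> occs [] \<phi>. \<chi> \<in> eHML \<and> resid [a] (eval \<psi> (ctx_val \<Gamma>)) \<subseteq> eval \<chi> (ctx_val \<Delta>)"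
    if "(\<Gamma>, \<psi>) \<in> occs [] \<phi>" "\<psi> \<in> eHML" for \<Gamma> \<psi> a
    using that
  \<comment> \<open>A variable met before any modality is replaced by its binder, whose context is a
    proper suffix of \<open>\<Gamma>\<close>.\<close>
  proof (induction "length \<Gamma>" arbitrary: \<Gamma> \<psi> rule: less_induct)
    case less
    note sub = occs_trans[OF less.prems(1)]
    have "\<psi> \<in> sHML" "guarded \<psi>"
      using less.prems sHML_occs guarded_occs assms(2,3) by blast+
    then consider \<Delta> \<chi> where "(\<Delta>, \<chi>) \<in> occs \<Gamma> \<psi>" "\<chi> \<in> eHML"
        "resid [a] (eval \<psi> (ctx_val \<Gamma>)) \<subseteq> eval \<chi> (ctx_val \<Delta>)"
      | X where "X \<in> unguarded \<psi>" "eval \<psi> (ctx_val \<Gamma>) \<subseteq> ctx_val \<Gamma> X"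
      using eHML_step[of \<psi> \<Gamma> a] less.prems(2) no_TT sub by blast
    then show ?case
    proof cases
      case 1
      then show ?thesis using sub by blast
    next
      case (2 X)
      then have "X \<in> fv \<psi>" using unguarded_subset_fv by blast
      from scope[OF less.prems(1) this] obtain \<Gamma>\<^sub>1 \<theta> \<Gamma>\<^sub>2 where *: "\<Gamma> = \<Gamma>\<^sub>1 @ \<theta> # \<Gamma>\<^sub>2" "binds X \<theta>"
        "\<forall>\<theta>'\<in>set \<Gamma>\<^sub>1. \<not> binds X \<theta>'" "(\<Gamma>\<^sub>2, \<theta>) \<in> occs [] \<phi>"
        unfolding bound_in_scope_def by blast
      have "\<theta> \<in> sHML" using *(4) sHML_occs assms(3) by blast
      then obtain \<eta> where \<theta>: "\<theta> = FMax X \<eta>" using *(2) by (auto simp: binds_def)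
      then have "\<theta> \<in> eHML" using *(4) FMax_occs_eHML assms(4) by blast
      then obtain \<Delta> \<chi> where "(\<Delta>, \<chi>) \<in> occs [] \<phi>" "\<chi> \<in> eHML"
        "resid [a] (eval \<theta> (ctx_val \<Gamma>\<^sub>2)) \<subseteq> eval \<chi> (ctx_val \<Delta>)"
        using less.hyps[OF _ *(4)] *(1) by auto
      moreover have "eval \<psi> (ctx_val \<Gamma>) \<subseteq> eval \<theta> (ctx_val \<Gamma>\<^sub>2)"
        using 2(2) ctx_val_lookup[OF *(3)] *(1) \<theta> by simp
      ultimately show ?thesis using resid_mono by blast
    qed
  qed
  have refutable: "refutable (eval \<psi> (ctx_val \<Gamma>))" if occ: "(\<Gamma>, \<psi>) \<in> occs [] \<phi>" for \<Gamma> \<psi>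
  proof -
    obtain k where "can_refute_in k \<Gamma> \<psi>" using bspec[OF ref occ] unfolding can_refute_def by auto
    moreover have "set \<Gamma> \<subseteq> sHML"
      using sHML_ctx[OF occ assms(3)] by simp
    ultimately show ?thesis
      using refutable_if_can_refute_in[OF _ sHML_occs[OF occ assms(3)]] by blast
  qed
  \<comment> \<open>The upper bounds from \<open>step\<close> are chained along \<open>s\<close>;
    the occurrence reached at the end is refutable, hence so is the smaller residual.\<close>
  have "refutable (resid s (eval \<psi> (ctx_val \<Gamma>)))" if "(\<Gamma>, \<psi>) \<in> occs [] \<phi>" "\<psi> \<in> eHML" for s \<Gamma> \<psi>
    using that
  proof (induction s arbitrary: \<Gamma> \<psi>)
    case Nil
    then show ?case using refutable by simp
  next
    case (Cons a s)
    from step[OF Cons.prems, of a] obtain \<Delta> \<chi> where "(\<Delta>, \<chi>) \<in> occs [] \<phi>" "\<chi> \<in> eHML"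
      and sub: "resid [a] (eval \<psi> (ctx_val \<Gamma>)) \<subseteq> eval \<chi> (ctx_val \<Delta>)" by blast
    then have "refutable (resid s (eval \<chi> (ctx_val \<Delta>)))" using Cons.IH by blast
    then show ?case unfolding resid_Cons[of a s] using resid_mono[OF sub] by (rule refutable_subset)
  qed
  from this[OF occs_self assms(4)] show ?thesis
    unfolding dense_def refutable_def sem_def resid_append by simp
qed

section \<open>Unravelling a residual automaton\<close>

lemma big_box_exists: "finite A \<Longrightarrow> A \<noteq> {} \<Longrightarrow> \<exists>\<chi>. big_box A F \<chi>"
proof (induction rule: finite_ne_induct)
  case (singleton a)
  show ?case by (rule exI, rule big_box.intros(1))
next
  case (insert a A)
  then obtain \<chi> where "big_box A F \<chi>" by blast
  then have "big_box ({a} \<union> A) F (And (Box a (F a)) \<chi>)"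
    using insert.hyps by (intro big_box.intros) auto
  then show ?case by auto
qed

lemma big_box_props:
  assumes "big_box A F \<chi>"
  shows "(\<And>a. F a \<in> sHML) \<Longrightarrow> \<chi> \<in> sHML"
    and "(\<And>a. guarded (F a)) \<Longrightarrow> guarded \<chi>"
    and "unguarded \<chi> = {}"
    and "fv \<chi> = (\<Union>a\<in>A. fv (F a))"
  using assms by (induction rule: big_box.induct) simp_all

lemma big_box_eval:
  "big_box A F \<chi> \<Longrightarrow> (\<And>a. resid [a] P \<subseteq> eval (F a) \<rho>) \<Longrightarrow> P \<subseteq> eval \<chi> \<rho>"
proof (induction rule: big_box.induct)
  case (1 a F)
  then have "resid [a] P \<subseteq> eval (F a) \<rho>" .
  then show ?case by (auto simp: mem_resid1[symmetric])
qed auto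

section \<open>Syntactic refutability of compound formulae\<close>

lemma can_refute_cong:
  assumes "can_refute \<Gamma> \<psi>" "fv \<psi> \<subseteq> fv \<psi>'" "occurs_in FF \<psi> \<Longrightarrow> occurs_in FF \<psi>'"
  shows "can_refute \<Gamma> \<psi>'"
proof -
  have "can_refute_in k \<Gamma> \<psi> \<Longrightarrow> can_refute_in k \<Gamma> \<psi>'" for k
    using assms(2,3) by (induction k) (simp; blast)+
  then show ?thesis using assms(1) unfolding can_refute_def by blast
qed

lemma occurs_in_occs1: "(\<Gamma>, \<psi>) \<in> occs [] \<psi>' \<Longrightarrow> occurs_in \<chi> \<psi> \<Longrightarrow> occurs_in \<chi> \<psi>'"
  using occurs_in_occs[of \<chi> \<psi> \<Gamma>] occs_trans unfolding occurs_in_def by blast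

lemma can_refute_And1: "can_refute \<Gamma> \<phi> \<Longrightarrow> can_refute \<Gamma> (And \<phi> \<psi>)"
  by (erule can_refute_cong) (auto simp: occs_self elim: occurs_in_occs1[of "[]", rotated])

lemma can_refute_Box: "can_refute \<Gamma> \<phi> \<Longrightarrow> can_refute \<Gamma> (Box a \<phi>)"
  by (erule can_refute_cong) (auto simp: occs_self elim: occurs_in_occs1[of "[]", rotated])

text \<open>A variable unfolded in the body refers either to this very fixpoint, which then can
  refute already, or to an outer binder. In the latter case it is free in the fixpoint too, and the
  same unfolding is available there.\<close>

lemma can_refute_FMax:
  assumes "can_refute (FMax X \<chi> # \<Gamma>) \<chi>"
  shows "can_refute \<Gamma> (FMax X \<chi>)"
proof -
  let ?\<theta> = "FMax X \<chi>"
  have "can_refute \<Gamma> ?\<theta>" if "can_refute_in k (?\<theta> # \<Gamma>) \<chi>" for k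
    using that
  proof (induction k)
    case 0
    then have "can_refute_in 0 \<Gamma> ?\<theta>"
      using occurs_in_occs1[of "[?\<theta>]" \<chi> ?\<theta>] by (simp add: occs_self)
    then show ?case unfolding can_refute_def ..
  next
    case (Suc k)
    from Suc.prems[unfolded can_refute_in.simps(2)] show ?case
    proof (elim disjE exE conjE)
      fix Y \<xi> \<Gamma>\<^sub>1 \<Gamma>\<^sub>2
      assume *: "Y \<in> fv \<chi>" "?\<theta> # \<Gamma> = \<Gamma>\<^sub>1 @ FMax Y \<xi> # \<Gamma>\<^sub>2" "\<forall>\<theta>\<in>set \<Gamma>\<^sub>1. \<not> binds Y \<theta>"
        "can_refute_in k \<Gamma>\<^sub>2 (FMax Y \<xi>)"
      show ?thesis
      proof (cases \<Gamma>\<^sub>1)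
        case Nil
        then show ?thesis using * unfolding can_refute_def by auto
      next
        case (Cons \<theta> \<Gamma>\<^sub>1')
        then have "Y \<noteq> X" "\<Gamma> = \<Gamma>\<^sub>1' @ FMax Y \<xi> # \<Gamma>\<^sub>2" using *(2,3) by (auto simp: binds_def)
        then have "can_refute_in (Suc k) \<Gamma> ?\<theta>"
          unfolding can_refute_in.simps(2) using * Cons
          by (intro disjI2 exI[of _ Y] exI[of _ \<xi>] exI[of _ \<Gamma>\<^sub>1'] exI[of _ \<Gamma>\<^sub>2]) auto
        then show ?thesis unfolding can_refute_def ..
      qed
    qed (rule Suc.IH)
  qed
  then show ?thesis using assms unfolding can_refute_def by blast
qed

lemma big_box_can_refute:
  "big_box A F \<chi> \<Longrightarrow> (\<And>a. can_refute \<Gamma> (F a)) \<Longrightarrow> can_refute \<Gamma> \<chi>"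
  by (induction rule: big_box.induct) (auto intro: can_refute_Box can_refute_And1)

lemma big_box_occs_can_refute:
  assumes "big_box A F \<chi>" "\<And>a. \<forall>(\<Delta>, \<xi>) \<in> occs \<Gamma> (F a). can_refute \<Delta> \<xi>"
  shows "\<forall>(\<Delta>, \<xi>) \<in> occs \<Gamma> \<chi>. can_refute \<Delta> \<xi>"
proof -
  have "can_refute \<Gamma> (F a)" for a using bspec[OF assms(2) occs_self] by simp
  with assms show ?thesis
  proof (induction rule: big_box.induct)
    case (1 a F)
    then show ?case using can_refute_Box[OF 1(2)[of a]] by auto
  next
    case (2 A F \<chi> B \<chi>')
    then have "can_refute \<Gamma> (And \<chi> \<chi>')" using can_refute_And1 big_box_can_refute by blast
    with 2 show ?case by auto
  qed
qed

section \<open>Monitors read off safety formulae\<close>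

text \<open>Only meaningful on sHML formulae without \<open>TT\<close>; the other clauses are junk.\<close>

primrec mon_of :: "(var \<Rightarrow> 'a mon) \<Rightarrow> 'a fm \<Rightarrow> 'a mon" where
  "mon_of \<sigma> TT = Verdict End"
| "mon_of \<sigma> FF = Verdict No"
| "mon_of \<sigma> (Or \<phi> \<psi>) = Verdict End"
| "mon_of \<sigma> (And \<phi> \<psi>) = Choice (mon_of \<sigma> \<phi>) (mon_of \<sigma> \<psi>)"
| "mon_of \<sigma> (Dia a \<phi>) = Verdict End"
| "mon_of \<sigma> (Box a \<phi>) = Pre a (mon_of \<sigma> \<phi>)"
| "mon_of \<sigma> (FMin X \<phi>) = Verdict End"
| "mon_of \<sigma> (FMax X \<phi>) = Rec X (mon_of (\<sigma>(X := MVar X)) \<phi>)"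
| "mon_of \<sigma> (Var X) = \<sigma> X"

lemma mfv_mon_of:
  "(\<And>x. mfv (\<sigma> x) = {} \<or> (\<sigma> x = MVar x \<and> x \<in> V)) \<Longrightarrow> mfv (mon_of \<sigma> \<psi>) \<subseteq> V"
proof (induction \<psi> arbitrary: \<sigma> V)
  case (FMax X \<psi>)
  have "mfv (mon_of (\<sigma>(X := MVar X)) \<psi>) \<subseteq> insert X V"
  proof (rule FMax.IH)
    show "mfv ((\<sigma>(X := MVar X)) x) = {} \<or> (\<sigma>(X := MVar X)) x = MVar x \<and> x \<in> insert X V" for x
      using FMax.prems[of x] by auto
  qed
  then show ?case by auto
next
  case (Var X)
  show ?case using Var[of X] by auto
qed simp_all

lemma msubst_fresh: "x \<notin> mfv m \<Longrightarrow> msubst p x m = m"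
  by (induction m) auto

text \<open>Unfolding a recursion thus becomes an update of the valuation. The premise keeps the
  substitution from touching the monitors inserted for other variables.\<close>

lemma msubst_mon_of:
  "(\<And>y. y \<noteq> x \<Longrightarrow> x \<notin> mfv (\<sigma> y)) \<Longrightarrow>
    msubst p x (mon_of (\<sigma>(x := MVar x)) \<psi>) = mon_of (\<sigma>(x := p)) \<psi>"
proof (induction \<psi> arbitrary: \<sigma>)
  case (FMax y \<psi>)
  show ?case
  proof (cases "y = x")
    case False
    have "msubst p x (mon_of ((\<sigma>(y := MVar y))(x := MVar x)) \<psi>) = mon_of ((\<sigma>(y := MVar y))(x := p)) \<psi>"
      using FMax.prems False by (intro FMax.IH) auto
    with False show ?thesis unfolding mon_of.simps msubst.simps fun_upd_twist[OF False] by simp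
  qed (simp only: mon_of.simps msubst.simps fun_upd_upd if_True simp_thms)
qed (simp_all add: msubst_fresh)

inductive_cases step_elims:
  "step (Verdict v) l n" "step (Pre a m) l n" "step (Choice m m') l n" "step (Rec x m) l n"

lemma step_big_box:
  "big_box A F \<chi> \<Longrightarrow> step (mon_of \<sigma> \<chi>) l n \<longleftrightarrow> (\<exists>a\<in>A. l = Vis a \<and> n = mon_of \<sigma> (F a))"
proof (induction rule: big_box.induct)
  case (1 a F)
  then show ?case by (auto elim: step_elims intro: step.intros)
next
  case (2 A F \<chi> B \<chi>')
  have "step (Choice (mon_of \<sigma> \<chi>) (mon_of \<sigma> \<chi>')) l n \<longleftrightarrow>
      (\<exists>a. l = Vis a) \<and> (step (mon_of \<sigma> \<chi>) l n \<or> step (mon_of \<sigma> \<chi>') l n)"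
    by (auto elim: step_elims intro: step.intros)
  with 2 show ?case by auto
qed

section \<open>The automaton of residuals and its unravelling\<close>

locale residual_automaton =
  fixes Q :: "'a::finite trace set set" and name :: "'a trace set \<Rightarrow> var"
  assumes finite_Q: "finite Q" and inj_name: "inj_on name Q"
    and resid_Q: "q \<in> Q \<Longrightarrow> resid [a] q \<in> Q"
begin

text \<open>\<open>\<Gamma>\<close> holds the states bound by enclosing fixpoints, so that a return
  to one of them becomes a back edge, namely its variable. A relation is used because
  \<open>big_box\<close> leaves order and bracketing open.\<close>

inductive unravel :: "'a trace set set \<Rightarrow> 'a trace set \<Rightarrow> 'a fm \<Rightarrow> bool" where
  unravel_empty: "unravel \<Gamma> {} FF"
| unravel_Var: "q \<in> \<Gamma> \<Longrightarrow> q \<noteq> {} \<Longrightarrow> unravel \<Gamma> q (Var (name q))"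
| unravel_FMax: "q \<notin> \<Gamma> \<Longrightarrow> q \<noteq> {} \<Longrightarrow> (\<And>a. unravel (insert q \<Gamma>) (resid [a] q) (F a)) \<Longrightarrow>
    big_box UNIV F \<chi> \<Longrightarrow> unravel \<Gamma> q (FMax (name q) \<chi>)"

text \<open>Each fixpoint adds a new state to \<open>\<Gamma>\<close>, so the finite set
  \<open>Q - \<Gamma>\<close> shrinks.\<close>

lemma unravel_exists: "\<Gamma> \<subseteq> Q \<Longrightarrow> q \<in> Q \<Longrightarrow> \<exists>\<psi>. unravel \<Gamma> q \<psi>"
proof (induction "card (Q - \<Gamma>)" arbitrary: \<Gamma> q rule: less_induct)
  case less
  show ?case
  proof (cases "q = {} \<or> q \<in> \<Gamma>")
    case True
    then show ?thesis using unravel_empty unravel_Var by blast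
  next
    case False
    then have "card (Q - insert q \<Gamma>) < card (Q - \<Gamma>)"
      using less.prems finite_Q by (intro psubset_card_mono) auto
    then have "\<exists>\<psi>. unravel (insert q \<Gamma>) (resid [a] q) \<psi>" for a
      using less.prems resid_Q by (intro less.hyps) auto
    then obtain F where "\<And>a. unravel (insert q \<Gamma>) (resid [a] q) (F a)" by metis
    moreover obtain \<chi> where "big_box UNIV F \<chi>" using big_box_exists[of UNIV F] by auto
    ultimately show ?thesis using False unravel_FMax by blast
  qed
qed

lemma unravel_grammar:
  "unravel \<Gamma> q \<psi> \<Longrightarrow> \<psi> \<in> sHML \<and> \<psi> \<in> eHML \<and> guarded \<psi> \<and> fv \<psi> \<subseteq> name ` \<Gamma>"
proof (induction rule: unravel.induct)
  case (unravel_FMax q \<Gamma> F \<chi>)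
  note box = big_box_props[OF unravel_FMax.hyps(4)]
  have IH: "F a \<in> sHML" "F a \<in> eHML" "guarded (F a)" "fv (F a) \<subseteq> insert (name q) (name ` \<Gamma>)" for a
    using unravel_FMax.IH[of a] by simp_all
  have "\<chi> \<in> eHML" using IH(2) unravel_FMax.hyps(4) by (rule eHML.intros)
  moreover have "fv \<chi> \<subseteq> insert (name q) (name ` \<Gamma>)" unfolding box(4) using IH(4) by blast
  ultimately show ?case using box(1-3) IH by (auto intro: eHML.intros)
qed (auto intro: eHML.intros)

text \<open>Coinduction: the bounds for the branches make \<open>q\<close> a post-fixed point of the
  body, hence a subset of the greatest fixpoint. Injectivity of \<open>name\<close> preserves the
  bounds for the other states when the valuation is updated at \<open>name q\<close>.\<close>

lemma unravel_eval:
  "unravel \<Gamma> q \<psi> \<Longrightarrow> \<Gamma> \<subseteq> Q \<Longrightarrow> q \<in> Q \<Longrightarrow> (\<And>p. p \<in> \<Gamma> \<Longrightarrow> p \<subseteq> \<rho> (name p)) \<Longrightarrow> q \<subseteq> eval \<psi> \<rho>"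
proof (induction arbitrary: \<rho> rule: unravel.induct)
  case (unravel_FMax q \<Gamma> F \<chi>)
  have upd: "p \<subseteq> (\<rho>(name q := q)) (name p)" if "p \<in> insert q \<Gamma>" for p
  proof (cases "p = q")
    case False
    then have "p \<in> \<Gamma>" "name p \<noteq> name q"
      using that unravel_FMax.prems(1,2) inj_onD[OF inj_name, of p q] by auto
    then show ?thesis using unravel_FMax.prems(3) by simp
  qed simp
  have "resid [a] q \<subseteq> eval (F a) (\<rho>(name q := q))" for a
    using unravel_FMax.prems(1,2) resid_Q upd by (intro unravel_FMax.IH) auto
  then have "q \<subseteq> eval \<chi> (\<rho>(name q := q))" using unravel_FMax.hyps(4) by (rule big_box_eval[rotated])
  then show ?case unfolding eval.simps by (rule gfp_upperbound)
qed auto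

text \<open>Links the syntactic context of an occurrence to the set of states bound there. Each
  entry comes with the unravelling of its state in the remaining context, so a variable can be
  traced to its binder and the argument continued from there.\<close>

inductive unravel_ctx :: "'a fm list \<Rightarrow> 'a trace set set \<Rightarrow> bool" where
  "unravel_ctx [] {}"
| "unravel_ctx \<Delta> \<Gamma> \<Longrightarrow> q \<in> Q \<Longrightarrow> q \<notin> \<Gamma> \<Longrightarrow> unravel \<Gamma> q (FMax (name q) \<chi>) \<Longrightarrow>
    unravel_ctx (FMax (name q) \<chi> # \<Delta>) (insert q \<Gamma>)"

lemma unravel_ctx_subset: "unravel_ctx \<Delta> \<Gamma> \<Longrightarrow> \<Gamma> \<subseteq> Q"
  by (induction rule: unravel_ctx.induct) auto

lemma unravel_ctx_lookup:
  "unravel_ctx \<Delta> \<Gamma> \<Longrightarrow> p \<in> \<Gamma> \<Longrightarrow> \<exists>\<Delta>\<^sub>1 \<chi> \<Delta>\<^sub>2 \<Gamma>'. \<Delta> = \<Delta>\<^sub>1 @ FMax (name p) \<chi> # \<Delta>\<^sub>2 \<and>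
    (\<forall>\<theta>\<in>set \<Delta>\<^sub>1. \<not> binds (name p) \<theta>) \<and> unravel_ctx \<Delta>\<^sub>2 \<Gamma>' \<and> p \<notin> \<Gamma>' \<and> p \<in> Q \<and>
    unravel \<Gamma>' p (FMax (name p) \<chi>)"
proof (induction rule: unravel_ctx.induct)
  case (2 \<Delta> \<Gamma> q \<chi>)
  show ?case
  proof (cases "p = q")
    case True
    then show ?thesis using 2(1-4) by (intro exI[of _ "[]"]) auto
  next
    case False
    then have "p \<in> \<Gamma>" using 2 by simp
    then have "name p \<noteq> name q"
      using False 2(1,2) unravel_ctx_subset inj_onD[OF inj_name, of p q] by blast
    then have "\<not> binds (name p) (FMax (name q) \<chi>)" by (simp add: binds_def)
    moreover obtain \<Delta>\<^sub>1 \<xi> \<Delta>\<^sub>2 \<Gamma>' where "\<Delta> = \<Delta>\<^sub>1 @ FMax (name p) \<xi> # \<Delta>\<^sub>2"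
      "\<forall>\<theta>\<in>set \<Delta>\<^sub>1. \<not> binds (name p) \<theta>" "unravel_ctx \<Delta>\<^sub>2 \<Gamma>'" "p \<notin> \<Gamma>'" "p \<in> Q"
      "unravel \<Gamma>' p (FMax (name p) \<xi>)"
      using 2(5) \<open>p \<in> \<Gamma>\<close> by blast
    ultimately show ?thesis
      by (intro exI[of _ "FMax (name q) \<chi> # \<Delta>\<^sub>1"] exI[of _ \<xi>] exI[of _ \<Delta>\<^sub>2] exI[of _ \<Gamma>']) simp
  qed
qed simp

lemma unravel_emptyD: "unravel \<Gamma> {} \<psi> \<Longrightarrow> \<psi> = FF"
  by (auto elim: unravel.cases)

text \<open>Induction on a word leading from \<open>q\<close> to the empty residual. The empty word
  means \<open>FF\<close>, a fixpoint follows the branch of the first letter, and a variable spends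
  one unfolding to get to the fixpoint of the same state.\<close>

lemma can_refute_unravel:
  assumes "resid u q = {}" "unravel_ctx \<Delta> \<Gamma>" "q \<in> Q" "unravel \<Gamma> q \<psi>"
  shows "can_refute \<Delta> \<psi>"
  using assms
proof (induction u arbitrary: q \<Delta> \<Gamma> \<psi>)
  have *: "can_refute \<Delta> FF" for \<Delta> :: "'a fm list"
    unfolding can_refute_def by (rule exI[of _ 0]) (simp add: occurs_in_def)
  {
    case Nil
    then show ?case using * unravel_emptyD by auto
  next
    case (Cons a u)
    \<comment> \<open>Stated for arbitrary contexts, because the variable case applies it in the
      shorter context of the binder.\<close>
    have FMax: "can_refute \<Delta> (FMax (name q) \<chi>)"
      if ctx: "unravel_ctx \<Delta> \<Gamma>" "q \<notin> \<Gamma>" and \<chi>: "unravel \<Gamma> q (FMax (name q) \<chi>)" for \<Delta> \<Gamma> \<chi>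
    proof -
      obtain F where F: "\<And>a. unravel (insert q \<Gamma>) (resid [a] q) (F a)" "big_box UNIV F \<chi>"
        using \<chi> by (cases rule: unravel.cases) auto
      have "can_refute (FMax (name q) \<chi> # \<Delta>) (F a)"
      proof (rule Cons.IH)
        show "resid u (resid [a] q) = {}" using Cons.prems(1) resid_Cons[of a u q] by simp
        show "unravel_ctx (FMax (name q) \<chi> # \<Delta>) (insert q \<Gamma>)"
          using ctx \<chi> Cons.prems(3) by (intro unravel_ctx.intros)
      qed (use Cons.prems(3) resid_Q F in auto)
      moreover have "(\<Gamma>', F a) \<in> occs \<Gamma>' \<chi>" for \<Gamma>' using big_box_at[OF F(2)] by blast
      moreover have "fv (F a) \<subseteq> fv \<chi>" using big_box_props(4)[OF F(2)] by blast
      ultimately have "can_refute (FMax (name q) \<chi> # \<Delta>) \<chi>"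
        using can_refute_cong occurs_in_occs1 by metis
      then show ?thesis by (rule can_refute_FMax)
    qed
    from Cons.prems(4) show ?case
    proof cases
      case unravel_empty
      then show ?thesis using * by simp
    next
      case unravel_Var
      obtain \<Delta>\<^sub>1 \<chi> \<Delta>\<^sub>2 \<Gamma>' where l: "\<Delta> = \<Delta>\<^sub>1 @ FMax (name q) \<chi> # \<Delta>\<^sub>2"
        "\<forall>\<theta>\<in>set \<Delta>\<^sub>1. \<not> binds (name q) \<theta>" "unravel_ctx \<Delta>\<^sub>2 \<Gamma>'" "q \<notin> \<Gamma>'"
        "unravel \<Gamma>' q (FMax (name q) \<chi>)"
        using unravel_ctx_lookup[OF Cons.prems(2) unravel_Var(2)] by blast
      then obtain k where "can_refute_in k \<Delta>\<^sub>2 (FMax (name q) \<chi>)"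
        using FMax unfolding can_refute_def by blast
      then have "can_refute_in (Suc k) \<Delta> (Var (name q))"
        unfolding can_refute_in.simps(2) using l(1,2)
        by (intro disjI2 exI[of _ "name q"] exI[of _ \<chi>] exI[of _ \<Delta>\<^sub>1] exI[of _ \<Delta>\<^sub>2]) simp
      then show ?thesis unfolding can_refute_def unravel_Var(1) by blast
    next
      case unravel_FMax
      then show ?thesis using FMax Cons.prems(2,4) by simp
    qed
  }
qed

lemma can_refute_unravel_occs:
  assumes ref: "\<And>q. q \<in> Q \<Longrightarrow> refutable q"
  shows "unravel \<Gamma> q \<psi> \<Longrightarrow> unravel_ctx \<Delta> \<Gamma> \<Longrightarrow> q \<in> Q \<Longrightarrow> \<forall>(\<Delta>', \<xi>) \<in> occs \<Delta> \<psi>. can_refute \<Delta>' \<xi>"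
proof (induction arbitrary: \<Delta> rule: unravel.induct)
  case (unravel_empty \<Gamma>)
  then show ?case
    using can_refute_unravel[of "[]", OF _ _ _ unravel.unravel_empty] by simp
next
  case (unravel_Var q \<Gamma>)
  moreover obtain u where "resid u q = {}" using ref unravel_Var.prems unfolding refutable_def by blast
  ultimately show ?case using can_refute_unravel unravel.unravel_Var by simp
next
  case (unravel_FMax q \<Gamma> F \<chi>)
  have \<theta>: "unravel \<Gamma> q (FMax (name q) \<chi>)"
    using unravel_FMax.hyps by (intro unravel.unravel_FMax)
  obtain u where "resid u q = {}" using ref unravel_FMax.prems unfolding refutable_def by blast
  then have "can_refute \<Delta> (FMax (name q) \<chi>)"
    using can_refute_unravel \<theta> unravel_FMax.prems by blast
  moreover have "unravel_ctx (FMax (name q) \<chi> # \<Delta>) (insert q \<Gamma>)"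
    using unravel_FMax.prems unravel_FMax.hyps(1) \<theta> by (intro unravel_ctx.intros)
  then have "\<forall>(\<Delta>', \<xi>) \<in> occs (FMax (name q) \<chi> # \<Delta>) \<chi>. can_refute \<Delta>' \<xi>"
    using unravel_FMax.IH unravel_FMax.prems(2) resid_Q
    by (intro big_box_occs_can_refute[OF unravel_FMax.hyps(4)]) blast
  ultimately show ?case by simp
qed

section \<open>Monitor states and the residuals they stand for\<close>

text \<open>
  The valuation \<open>\<sigma>\<close> holds the monitors substituted for the variables of the unfolded recursions;
  the last premise makes looping back to a visited residual \<open>p\<close> continue in a state for \<open>p\<close>.
\<close>

inductive mon_state :: "'a trace set \<Rightarrow> 'a mon \<Rightarrow> bool" where
  "unravel \<Gamma> q \<psi> \<Longrightarrow> \<Gamma> \<subseteq> Q \<Longrightarrow> q \<in> Q \<Longrightarrow> q \<notin> \<Gamma> \<Longrightarrow> (\<And>y. mfv (\<sigma> y) = {}) \<Longrightarrow>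
    (\<And>p. p \<in> \<Gamma> \<Longrightarrow> mon_state p (\<sigma> (name p))) \<Longrightarrow> mon_state q (mon_of \<sigma> \<psi>)"

lemma mfv_mon_state: "mon_state q m \<Longrightarrow> mfv m = {}"
  by (auto elim!: mon_state.cases dest!: mfv_mon_of[THEN subsetD, rotated, of _ _ _ "{}"])

text \<open>Unfolding the recursion substitutes \<open>m\<close> for its own variable. As
  \<open>m\<close> is a state for \<open>q\<close>, every loop back to \<open>q\<close> is served,
  and each branch is again a state, for the residual by its letter.\<close>

lemma mon_state_cases:
  assumes "mon_state q m"
  obtains "q = {}" "m = Verdict No"
  | x n where "q \<noteq> {}" "m = Rec x n"
    "\<And>l n. step m l n \<Longrightarrow> \<exists>a. l = Vis a \<and> mon_state (resid [a] q) n"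
    "\<And>a. \<exists>n. step m (Vis a) n \<and> mon_state (resid [a] q) n"
  using assms
proof cases
  case (1 \<Gamma> \<psi> \<sigma>)
  from 1(2) show ?thesis
  proof cases
    case unravel_empty
    then show ?thesis using 1(1) that(1) by simp
  next
    case unravel_Var
    then show ?thesis using 1(5) by simp
  next
    case (unravel_FMax F \<chi>)
    \<comment> \<open>The valuation after unfolding: the variable of \<open>q\<close> stands for the
      whole monitor.\<close>
    let ?\<sigma> = "\<sigma>(name q := m)"
    have m: "m = Rec (name q) (mon_of (\<sigma>(name q := MVar (name q))) \<chi>)"
      using 1(1) unravel_FMax(1) by simp
    have closed: "mfv (?\<sigma> y) = {}" for y using 1(6) mfv_mon_state[OF assms] by simp
    have \<sigma>: "mon_state p (?\<sigma> (name p))" if "p \<in> insert q \<Gamma>" for p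
    proof (cases "p = q")
      case False
      then have "p \<in> \<Gamma>" "name p \<noteq> name q"
        using that 1(3,4) inj_onD[OF inj_name, of p q] by auto
      then show ?thesis using 1(7) by simp
    qed (use assms in simp)
    have F: "mon_state (resid [a] q) (mon_of ?\<sigma> (F a))" for a
    proof (cases "resid [a] q \<in> insert q \<Gamma>")
      case False
      moreover have "insert q \<Gamma> \<subseteq> Q" using 1(3,4) by simp
      ultimately show ?thesis
        using mon_state.intros[OF unravel_FMax(4) _ resid_Q[OF 1(4)] _ closed \<sigma>] by blast
    next
      case True
      from unravel_FMax(4)[of a] show ?thesis
      proof cases
        case unravel_empty
        \<comment> \<open>Here the empty residual belongs to the context, which the introduction
          rule forbids. So \<open>FF\<close> is unravelled anew in the empty context, with a closed
          dummy valuation.\<close>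
        then show ?thesis
          using mon_state.intros[OF unravel.unravel_empty[of "{}"], of "\<lambda>_. Verdict End"] resid_Q[OF 1(4), of a]
          by simp
      next
        case unravel_Var
        then show ?thesis using \<sigma>[OF True] by simp
      next
        case unravel_FMax
        then show ?thesis using True by blast
      qed
    qed
    have "step m (Vis a) n \<longleftrightarrow> step (mon_of ?\<sigma> \<chi>) (Vis a) n" for a n
      using msubst_mon_of[of "name q" \<sigma> m \<chi>] 1(6) m
      by (auto elim: step_elims intro: step.intros)
    then have step: "step m (Vis a) n \<longleftrightarrow> n = mon_of ?\<sigma> (F a)" for a n
      using step_big_box[OF unravel_FMax(5)] by simp
    show ?thesis
    proof (rule that(2)[OF unravel_FMax(3) m])
      fix l n assume n: "step m l n"
      then obtain a where "l = Vis a" using m by (auto elim: step_elims)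
      with n show "\<exists>a. l = Vis a \<and> mon_state (resid [a] q) n" using step F by auto
    next
      show "\<exists>n. step m (Vis a) n \<and> mon_state (resid [a] q) n" for a using step F by auto
    qed
  qed
qed

text \<open>States are \<open>No\<close> or recursions, so no silent step occurs, and each visible
  step takes one residual. A \<open>No\<close> state stays put, as does the empty residual.\<close>

lemma mon_state_reaches: "reaches m s n \<Longrightarrow> mon_state q m \<Longrightarrow> mon_state (resid s q) n"
proof (induction arbitrary: q rule: reaches.induct)
  case (2 m m' s n)
  from 2(4) show ?case
    by (cases rule: mon_state_cases) (use 2 in \<open>auto elim: step_elims\<close>)
next
  case (3 m a m' s n)
  have "mon_state (resid [a] q) m'"
    using 3(4)
  proof (cases rule: mon_state_cases)
    case 1
    then have "m' = m" using 3(1) by (auto elim: step_elims)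
    then show ?thesis using 1 3(4) by simp
  next
    case 2
    then show ?thesis using 3(1) by blast
  qed
  then show ?case using 3(3) resid_Cons[of a s q] by simp
qed simp

text \<open>One direction is the invariant \<open>mon_state_reaches\<close>. Conversely, every
  action can be read in every state, and a state for \<open>{}\<close> can only be
  \<open>No\<close>.\<close>

lemma reaches_No_iff:
  assumes "mon_state q m"
  shows "reaches m s (Verdict No) \<longleftrightarrow> resid s q = {}"
proof
  assume "reaches m s (Verdict No)"
  then have "mon_state (resid s q) (Verdict No)" using mon_state_reaches assms by blast
  then show "resid s q = {}" by (cases rule: mon_state_cases) auto
next
  assume "resid s q = {}"
  then show "reaches m s (Verdict No)"
    using assms
  proof (induction s arbitrary: q m)
    case Nil
    then have "m = Verdict No" by (auto elim: mon_state_cases)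
    then show ?case by (simp add: reaches.intros)
  next
    case (Cons a s)
    obtain n where "step m (Vis a) n" "mon_state (resid [a] q) n"
      using Cons.prems(2)
    proof (cases rule: mon_state_cases)
      case 1
      then show thesis using that[of m] Cons.prems(2) by (simp add: step.intros(2))
    next
      case 2
      then show thesis using that by blast
    qed
    then show ?case
      using Cons.IH[of "resid [a] q" n] Cons.prems(1) resid_Cons[of a s q] reaches.intros(3) by metis
  qed
qed

lemma not_reaches_Yes: "mon_state q m \<Longrightarrow> \<not> reaches m s (Verdict Yes)"
proof
  assume "mon_state q m" "reaches m s (Verdict Yes)"
  then have "mon_state (resid s q) (Verdict Yes)" using mon_state_reaches by blast
  then show False by (cases rule: mon_state_cases) auto
qed

end

section \<open>Informative monitors and density\<close>

lemma reaches_Verdict: "reaches (Verdict v) u (Verdict v)"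
  by (induction u) (auto intro: reaches.intros step.intros)

lemma reaches_verdict_append: "reaches m s (Verdict v) \<Longrightarrow> reaches m (s @ u) (Verdict v)"
  by (induction s "Verdict v :: 'a mon" rule: reaches.induct)
    (auto intro: reaches.intros reaches_Verdict)

lemma dense_if_violation_persistently_informative:
  assumes "sound m P" "violation_persistently_informative m"
  shows "dense P"
  unfolding dense_def
proof
  fix s
  obtain f where f: "rejects m (tapp s f)"
    using assms(2) unfolding violation_persistently_informative_def by blast
  obtain u where u: "reaches m (s @ u) (Verdict No)"
  proof (cases f)
    case (Fin u)
    then show thesis using f that by simp
  next
    case (Inf t)
    then obtain k where k: "reaches m (stake k (s @- t)) (Verdict No)" using f by auto
    \<comment> \<open>The rejecting prefix of length \<open>k\<close> may end inside
      \<open>s\<close> or go beyond it. Extended by \<open>length s\<close> letters it has the form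
      \<open>s @ u\<close> and is still rejected.\<close>
    have "s @ stake k t = stake (length s + k) (s @- t)" by (simp add: stake_shift)
    also have "\<dots> = stake k (s @- t) @ stake (length s) (sdrop k (s @- t))"
      by (metis add.commute stake_add)
    finally show thesis
      using that[of "stake k t"] reaches_verdict_append[OF k] by (simp only:)
  qed
  have "tapp (s @ u) g \<notin> P" for g
  proof -
    have "rejects m (tapp (s @ u) g)"
    proof (cases g)
      case (Fin w)
      then show ?thesis using reaches_verdict_append[OF u] by (simp del: tapp_append)
    next
      case (Inf t)
      have "stake (length (s @ u)) ((s @ u) @- t) = s @ u" by (simp add: stake_shift)
      then show ?thesis using u unfolding Inf tapp.simps rejects.simps by metis
    qed
    then show ?thesis using assms(1) unfolding sound_def by blast
  qed
  then have "resid (s @ u) P = {}" unfolding resid_def by blast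
  then show "\<exists>u. resid (s @ u) P = {}" ..
qed

lemma monitor_if_dense:
  fixes P :: "'a::finite trace set"
  assumes fin: "finite (range (\<lambda>s. resid s P))" and dense: "dense P"
  shows "\<exists>m\<in>Mon. sound m P \<and> violation_persistently_informative m" (is ?monitor)
    and "\<exists>\<psi>. \<psi> \<in> sHML \<and> \<psi> \<in> eHML \<and> guarded \<psi> \<and> fv \<psi> = {} \<and> P \<subseteq> sem \<psi> \<and>
      (\<forall>(\<Gamma>, \<xi>) \<in> occs [] \<psi>. can_refute \<Gamma> \<xi>)" (is ?formula)
proof -
  let ?Q = "range (\<lambda>s. resid s P)"
  obtain name :: "'a trace set \<Rightarrow> var" where "inj_on name ?Q"
    using finite_imp_inj_to_nat_seg[OF fin] by blast
  then interpret residual_automaton ?Q name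
    using fin by unfold_locales (auto simp: resid_append[symmetric])
  have P: "P \<in> ?Q" using resid_Nil by (rule range_eqI[OF sym])
  obtain \<psi> where \<psi>: "unravel {} P \<psi>" using unravel_exists[of "{}" P] P by blast
  \<comment> \<open>Every state is some \<open>resid s P\<close>, so density is precisely
    refutability of all states.\<close>
  have "refutable q" if "q \<in> ?Q" for q
    using that dense unfolding dense_def refutable_def by (auto simp: resid_append)
  then have "\<forall>(\<Gamma>, \<xi>) \<in> occs [] \<psi>. can_refute \<Gamma> \<xi>"
    using can_refute_unravel_occs[OF _ \<psi> unravel_ctx.intros(1) P] by blast
  moreover have "P \<subseteq> sem \<psi>" unfolding sem_def using unravel_eval[OF \<psi> _ P] by blast
  ultimately show ?formula using unravel_grammar[OF \<psi>] by auto
  \<comment> \<open>The formula is closed, so the valuation only has to consist of closed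
    monitors.\<close>
  let ?m = "mon_of (\<lambda>_. Verdict End) \<psi>"
  have m: "mon_state P ?m" using \<psi> P by (intro mon_state.intros) auto
  have "sound ?m P"
    unfolding sound_def
  proof (intro allI conjI impI)
    fix f
    assume "accepts ?m f"
    then show "f \<in> P" using not_reaches_Yes[OF m] by (cases f) auto
  next
    fix f
    assume "rejects ?m f"
    then obtain s g where "resid s P = {}" "f = tapp s g"
    proof (cases f)
      case (Fin s)
      then show thesis
        using \<open>rejects ?m f\<close> that[of s "Fin []"] reaches_No_iff[OF m] by simp
    next
      case (Inf t)
      then obtain k where "reaches ?m (stake k t) (Verdict No)" using \<open>rejects ?m f\<close> by auto
      then show thesis
        using Inf that[of "stake k t" "Inf (sdrop k t)"] reaches_No_iff[OF m] by (simp add: stake_sdrop)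
    qed
    then show "f \<notin> P" unfolding resid_def by blast
  qed
  moreover have "violation_persistently_informative ?m"
    unfolding violation_persistently_informative_def
  proof
    fix s
    obtain u where "resid (s @ u) P = {}" using dense unfolding dense_def by blast
    then have "rejects ?m (tapp s (Fin u))" using reaches_No_iff[OF m] by simp
    then show "\<exists>f. rejects ?m (tapp s f)" ..
  qed
  moreover have "?m \<in> Mon" using mfv_mon_state[OF m] by (simp add: Mon_def)
  ultimately show ?monitor by blast
qed

lemma violation_characterisation:
  fixes \<phi> :: "'a::finite fm"
  assumes "\<phi> \<in> muHML"
  shows "(\<exists>m \<in> Mon. sound m (sem \<phi>) \<and> violation_persistently_informative m) \<longleftrightarrow>
    (\<exists>\<psi> \<in> SPIHML. sem \<psi> = sem \<phi>)"
proof
  assume "\<exists>m \<in> Mon. sound m (sem \<phi>) \<and> violation_persistently_informative m"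
  then have "dense (sem \<phi>)" using dense_if_violation_persistently_informative by blast
  from monitor_if_dense(2)[OF finite_residuals[OF assms] this]
  obtain \<psi> where \<psi>: "\<psi> \<in> sHML" "\<psi> \<in> eHML" "guarded \<psi>" "fv \<psi> = {}" "sem \<phi> \<subseteq> sem \<psi>"
    "\<forall>(\<Gamma>, \<xi>) \<in> occs [] \<psi>. can_refute \<Gamma> \<xi>" by blast
  \<comment> \<open>The unravelled formula follows from \<open>\<phi>\<close>, so adding it as left
    conjunct keeps the semantics.\<close>
  then have "And \<psi> \<phi> \<in> SPIHML" using assms by (auto simp: SPIHML_def muHML_def)
  moreover have "sem (And \<psi> \<phi>) = sem \<phi>" using \<psi>(5) by (auto simp: sem_def)
  ultimately show "\<exists>\<psi> \<in> SPIHML. sem \<psi> = sem \<phi>" by blast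
next
  assume "\<exists>\<psi> \<in> SPIHML. sem \<psi> = sem \<phi>"
  then obtain \<phi>\<^sub>1 \<phi>\<^sub>2 where *: "sem (And \<phi>\<^sub>1 \<phi>\<^sub>2) = sem \<phi>" "And \<phi>\<^sub>1 \<phi>\<^sub>2 \<in> muHML" "\<phi>\<^sub>1 \<in> sHML" "\<phi>\<^sub>1 \<in> eHML"
    "\<forall>(\<Gamma>, \<psi>) \<in> occs [] \<phi>\<^sub>1. can_refute \<Gamma> \<psi>" unfolding SPIHML_def by blast
  have "dense (sem \<phi>\<^sub>1)" using * by (intro dense_if_can_refute) (auto simp: muHML_def)
  moreover have "sem \<phi> \<subseteq> sem \<phi>\<^sub>1" using *(1) by (auto simp: sem_def)
  ultimately have "dense (sem \<phi>)" by (rule dense_mono)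
  then show "\<exists>m \<in> Mon. sound m (sem \<phi>) \<and> violation_persistently_informative m"
    by (rule monitor_if_dense(1)[OF finite_residuals[OF assms]])
qed

section \<open>Duality\<close>

primrec dual :: "'a fm \<Rightarrow> 'a fm" where
  "dual TT = FF"
| "dual FF = TT"
| "dual (Or \<phi> \<psi>) = And (dual \<phi>) (dual \<psi>)"
| "dual (And \<phi> \<psi>) = Or (dual \<phi>) (dual \<psi>)"
| "dual (Dia a \<phi>) = Box a (dual \<phi>)"
| "dual (Box a \<phi>) = Dia a (dual \<phi>)"
| "dual (FMin X \<phi>) = FMax X (dual \<phi>)"
| "dual (FMax X \<phi>) = FMin X (dual \<phi>)"
| "dual (Var X) = Var X"

lemma dual_dual [simp]: "dual (dual \<phi>) = \<phi>"
  by (induction \<phi>) auto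

lemma fv_dual [simp]: "fv (dual \<phi>) = fv \<phi>"
  by (induction \<phi>) auto

lemma unguarded_dual [simp]: "unguarded (dual \<phi>) = unguarded \<phi>"
  by (induction \<phi>) auto

lemma guarded_dual [simp]: "guarded (dual \<phi>) = guarded \<phi>"
  by (induction \<phi>) auto

text \<open>Complementation turns the pre-fixed points of \<open>F\<close> into the post-fixed
  points of the conjugated operator, and the union of the complements is the complement of the
  intersection.\<close>

lemma gfp_compl: "gfp (\<lambda>S. - F (- S)) = - lfp (F :: 'b set \<Rightarrow> 'b set)"
proof -
  have "gfp (\<lambda>S. - F (- S)) = \<Union> {S. F (- S) \<subseteq> - S}"
    unfolding gfp_def by (rule arg_cong[where f = Union]) blast
  also have "{S. F (- S) \<subseteq> - S} = uminus ` {S. F S \<subseteq> S}"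
    by (auto intro: image_eqI[of _ _ "- _"])
  finally show ?thesis unfolding lfp_def by (simp add: uminus_Inf)
qed

text \<open>Variables are self-dual, so the valuation has to be complemented along with the formula.
  The bodies of dual fixpoints then define conjugated operators.\<close>

lemma eval_dual: "eval (dual \<phi>) (\<lambda>X. - \<rho> X) = - eval \<phi> \<rho>"
proof (induction \<phi> arbitrary: \<rho>)
  case (FMin X \<phi>)
  have "eval (dual \<phi>) ((\<lambda>X. - \<rho> X)(X := S)) = - eval \<phi> (\<rho>(X := - S))" for S
    using FMin[of "\<rho>(X := - S)"] by (simp add: fun_upd_def if_distrib cong: if_cong)
  then show ?case using gfp_compl[of "\<lambda>S. eval \<phi> (\<rho>(X := S))"] by simp
next
  case (FMax X \<phi>)
  have "eval (dual \<phi>) ((\<lambda>X. - \<rho> X)(X := S)) = - eval \<phi> (\<rho>(X := - S))" for S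
    using FMax[of "\<rho>(X := - S)"] by (simp add: fun_upd_def if_distrib cong: if_cong)
  then have "eval (dual (FMax X \<phi>)) (\<lambda>X. - \<rho> X) = lfp (\<lambda>S. - eval \<phi> (\<rho>(X := - S)))" by simp
  \<comment> \<open>\<open>gfp_compl\<close> is applied to the conjugated operator, whose own
    conjugate is the original one.\<close>
  also have "\<dots> = - gfp (\<lambda>S. eval \<phi> (\<rho>(X := S)))"
    using gfp_compl[of "\<lambda>S. - eval \<phi> (\<rho>(X := - S))"] by simp
  finally show ?case by simp
qed auto

lemma eval_cong: "(\<And>X. X \<in> fv \<phi> \<Longrightarrow> \<rho> X = \<rho>' X) \<Longrightarrow> eval \<phi> \<rho> = eval \<phi> \<rho>'"
proof (induction \<phi> arbitrary: \<rho> \<rho>')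
  case (FMin X \<phi>)
  then have "eval \<phi> (\<rho>(X := S)) = eval \<phi> (\<rho>'(X := S))" for S by (intro FMin.IH) auto
  then show ?case by simp
next
  case (FMax X \<phi>)
  then have "eval \<phi> (\<rho>(X := S)) = eval \<phi> (\<rho>'(X := S))" for S by (intro FMax.IH) auto
  then show ?case by simp
next
  case (Or \<phi> \<psi>)
  have "eval \<phi> \<rho> = eval \<phi> \<rho>'" "eval \<psi> \<rho> = eval \<psi> \<rho>'" using Or.prems by (auto intro!: Or.IH)
  then show ?case by simp
next
  case (And \<phi> \<psi>)
  have "eval \<phi> \<rho> = eval \<phi> \<rho>'" "eval \<psi> \<rho> = eval \<psi> \<rho>'" using And.prems by (auto intro!: And.IH)
  then show ?case by simp
next
  case (Dia a \<phi>)
  have "eval \<phi> \<rho> = eval \<phi> \<rho>'" using Dia.prems by (auto intro!: Dia.IH)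
  then show ?case by simp
next
  case (Box a \<phi>)
  have "eval \<phi> \<rho> = eval \<phi> \<rho>'" using Box.prems by (auto intro!: Box.IH)
  then show ?case by simp
qed simp_all

text \<open>Complementing the valuation used in \<open>sem\<close> gives the constant full one;
  closedness allows changing it back.\<close>

lemma sem_dual: "fv \<phi> = {} \<Longrightarrow> sem (dual \<phi>) = - sem \<phi>"
  using eval_dual[of \<phi> "\<lambda>_. {}"] eval_cong[of "dual \<phi>" "\<lambda>_. UNIV" "\<lambda>_. {}"]
  by (simp add: sem_def)

lemma muHML_dual: "\<phi> \<in> muHML \<Longrightarrow> dual \<phi> \<in> muHML"
  by (simp add: muHML_def)

lemma cHML_dual: "\<phi> \<in> sHML \<Longrightarrow> dual \<phi> \<in> cHML"
  by (induction rule: sHML.induct) (auto intro: cHML.intros)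

lemma sHML_dual: "\<phi> \<in> cHML \<Longrightarrow> dual \<phi> \<in> sHML"
  by (induction rule: cHML.induct) auto

lemma big_box_dual: "big_dia A F \<chi> \<Longrightarrow> big_box A (\<lambda>a. dual (F a)) (dual \<chi>)"
proof (induction rule: big_dia.induct)
  case (1 a F)
  show ?case using big_box.intros(1)[of a "\<lambda>a. dual (F a)"] by simp
qed (simp add: big_box.intros)

lemma big_dia_dual: "big_box A F \<chi> \<Longrightarrow> big_dia A (\<lambda>a. dual (F a)) (dual \<chi>)"
proof (induction rule: big_box.induct)
  case (1 a F)
  show ?case using big_dia.intros(1)[of a "\<lambda>a. dual (F a)"] by simp
qed (simp add: big_dia.intros)

lemma eHML_dual: "\<phi> \<in> eHML \<Longrightarrow> dual \<phi> \<in> eHML"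
proof (induction rule: eHML.induct)
  case (8 F \<chi>)
  show ?case using 8(3) big_box_dual[OF 8(2)] by (rule eHML.intros)
next
  case (9 F \<chi>)
  show ?case using 9(3) big_dia_dual[OF 9(2)] by (rule eHML.intros)
qed (auto intro: eHML.intros)

lemma occs_dual: "(\<Delta>, \<chi>) \<in> occs \<Gamma> \<psi> \<Longrightarrow> (map dual \<Delta>, dual \<chi>) \<in> occs (map dual \<Gamma>) (dual \<psi>)"
  by (induction \<Gamma> \<psi> rule: occs.induct) auto

lemma occurs_in_dual: "occurs_in \<chi> \<psi> \<Longrightarrow> occurs_in (dual \<chi>) (dual \<psi>)"
  unfolding occurs_in_def using occs_dual[of _ \<chi> "[]" \<psi>] by auto

lemma binds_dual [simp]: "binds X (dual \<theta>) = binds X \<theta>"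
  by (cases \<theta>) (auto simp: binds_def)

lemma can_verify_dual: "can_refute_in k \<Gamma> \<psi> \<Longrightarrow> can_verify_in k (map dual \<Gamma>) (dual \<psi>)"
proof (induction k arbitrary: \<Gamma> \<psi>)
  case 0
  then show ?case using occurs_in_dual[of FF \<psi>] by simp
next
  case (Suc k)
  from Suc.prems[unfolded can_refute_in.simps(2)] show ?case
  proof (elim disjE exE conjE)
    fix X \<chi> \<Gamma>\<^sub>1 \<Gamma>\<^sub>2
    assume *: "X \<in> fv \<psi>" "\<Gamma> = \<Gamma>\<^sub>1 @ FMax X \<chi> # \<Gamma>\<^sub>2" "\<forall>\<theta>\<in>set \<Gamma>\<^sub>1. \<not> binds X \<theta>"
      "can_refute_in k \<Gamma>\<^sub>2 (FMax X \<chi>)"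
    show ?thesis
      unfolding can_verify_in.simps(2) using * Suc.IH[OF *(4)]
      by (intro disjI2 exI[of _ X] exI[of _ "dual \<chi>"] exI[of _ "map dual \<Gamma>\<^sub>1"]
          exI[of _ "map dual \<Gamma>\<^sub>2"]) simp
  qed (simp add: Suc.IH)
qed

lemma can_refute_dual: "can_verify_in k \<Gamma> \<psi> \<Longrightarrow> can_refute_in k (map dual \<Gamma>) (dual \<psi>)"
proof (induction k arbitrary: \<Gamma> \<psi>)
  case 0
  then show ?case using occurs_in_dual[of TT \<psi>] by simp
next
  case (Suc k)
  from Suc.prems[unfolded can_verify_in.simps(2)] show ?case
  proof (elim disjE exE conjE)
    fix X \<chi> \<Gamma>\<^sub>1 \<Gamma>\<^sub>2
    assume *: "X \<in> fv \<psi>" "\<Gamma> = \<Gamma>\<^sub>1 @ FMin X \<chi> # \<Gamma>\<^sub>2" "\<forall>\<theta>\<in>set \<Gamma>\<^sub>1. \<not> binds X \<theta>"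
      "can_verify_in k \<Gamma>\<^sub>2 (FMin X \<chi>)"
    show ?thesis
      unfolding can_refute_in.simps(2) using * Suc.IH[OF *(4)]
      by (intro disjI2 exI[of _ X] exI[of _ "dual \<chi>"] exI[of _ "map dual \<Gamma>\<^sub>1"]
          exI[of _ "map dual \<Gamma>\<^sub>2"]) simp
  qed (simp add: Suc.IH)
qed

lemma occs_dualE:
  assumes "(\<Delta>, \<chi>) \<in> occs [] (dual \<psi>)"
  obtains \<Delta>' \<chi>' where "(\<Delta>', \<chi>') \<in> occs [] \<psi>" "\<Delta> = map dual \<Delta>'" "\<chi> = dual \<chi>'"
proof (rule that)
  show "(map dual \<Delta>, dual \<chi>) \<in> occs [] \<psi>" using occs_dual[OF assms] by simp
qed (simp_all add: comp_def)

lemma CPIHML_dual: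
  assumes "\<psi> \<in> SPIHML"
  shows "dual \<psi> \<in> CPIHML"
proof -
  obtain \<phi>\<^sub>1 \<phi>\<^sub>2 where *: "\<psi> = And \<phi>\<^sub>1 \<phi>\<^sub>2" "\<psi> \<in> muHML" "\<phi>\<^sub>1 \<in> sHML" "\<phi>\<^sub>1 \<in> eHML"
    "\<forall>(\<Gamma>, \<psi>) \<in> occs [] \<phi>\<^sub>1. can_refute \<Gamma> \<psi>" using assms unfolding SPIHML_def by blast
  have "can_verify \<Gamma> \<chi>" if "(\<Gamma>, \<chi>) \<in> occs [] (dual \<phi>\<^sub>1)" for \<Gamma> \<chi>
    using that
  proof (rule occs_dualE)
    fix \<Gamma>' \<chi>' assume "(\<Gamma>', \<chi>') \<in> occs [] \<phi>\<^sub>1" and eq: "\<Gamma> = map dual \<Gamma>'" "\<chi> = dual \<chi>'"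
    then have "can_refute \<Gamma>' \<chi>'" using *(5) by blast
    then show ?thesis unfolding can_refute_def can_verify_def eq using can_verify_dual by blast
  qed
  then show ?thesis
    using muHML_dual[OF *(2)] *(1) cHML_dual[OF *(3)] eHML_dual[OF *(4)] unfolding CPIHML_def by auto
qed

lemma SPIHML_dual:
  assumes "\<psi> \<in> CPIHML"
  shows "dual \<psi> \<in> SPIHML"
proof -
  obtain \<phi>\<^sub>1 \<phi>\<^sub>2 where *: "\<psi> = Or \<phi>\<^sub>1 \<phi>\<^sub>2" "\<psi> \<in> muHML" "\<phi>\<^sub>1 \<in> cHML" "\<phi>\<^sub>1 \<in> eHML"
    "\<forall>(\<Gamma>, \<psi>) \<in> occs [] \<phi>\<^sub>1. can_verify \<Gamma> \<psi>" using assms unfolding CPIHML_def by blast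
  have "can_refute \<Gamma> \<chi>" if "(\<Gamma>, \<chi>) \<in> occs [] (dual \<phi>\<^sub>1)" for \<Gamma> \<chi>
    using that
  proof (rule occs_dualE)
    fix \<Gamma>' \<chi>' assume "(\<Gamma>', \<chi>') \<in> occs [] \<phi>\<^sub>1" and eq: "\<Gamma> = map dual \<Gamma>'" "\<chi> = dual \<chi>'"
    then have "can_verify \<Gamma>' \<chi>'" using *(5) by blast
    then show ?thesis unfolding can_refute_def can_verify_def eq using can_refute_dual by blast
  qed
  then show ?thesis
    using muHML_dual[OF *(2)] *(1) sHML_dual[OF *(3)] eHML_dual[OF *(4)] unfolding SPIHML_def by auto
qed

lemma ex_CPIHML_iff:
  assumes "\<phi> \<in> muHML"
  shows "(\<exists>\<psi>\<in>CPIHML. sem \<psi> = sem \<phi>) \<longleftrightarrow> (\<exists>\<psi>\<in>SPIHML. sem \<psi> = sem (dual \<phi>))"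
proof -
  have sem: "sem (dual \<psi>) = - sem \<psi>" if "\<psi> \<in> SPIHML \<union> CPIHML \<union> {\<phi>}" for \<psi>
    using that assms by (intro sem_dual) (auto simp: SPIHML_def CPIHML_def muHML_def)
  show ?thesis
  proof
    assume "\<exists>\<psi>\<in>CPIHML. sem \<psi> = sem \<phi>"
    then obtain \<psi> where "\<psi> \<in> CPIHML" "sem \<psi> = sem \<phi>" by blast
    then show "\<exists>\<psi>\<in>SPIHML. sem \<psi> = sem (dual \<phi>)"
      using sem[of \<psi>] sem[of \<phi>] SPIHML_dual by (intro bexI[of _ "dual \<psi>"]) auto
  next
    assume "\<exists>\<psi>\<in>SPIHML. sem \<psi> = sem (dual \<phi>)"
    then obtain \<psi> where "\<psi> \<in> SPIHML" "sem \<psi> = sem (dual \<phi>)" by blast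
    then show "\<exists>\<psi>\<in>CPIHML. sem \<psi> = sem \<phi>"
      using sem[of \<psi>] sem[of \<phi>] CPIHML_dual by (intro bexI[of _ "dual \<psi>"]) auto
  qed
qed

section \<open>Dual monitors\<close>

primrec dual_verdict :: "verdict \<Rightarrow> verdict" where
  "dual_verdict End = End"
| "dual_verdict No = Yes"
| "dual_verdict Yes = No"

primrec dual_parop :: "parop \<Rightarrow> parop" where
  "dual_parop PAnd = POr"
| "dual_parop POr = PAnd"

primrec dual_mon :: "'a mon \<Rightarrow> 'a mon" where
  "dual_mon (Verdict v) = Verdict (dual_verdict v)"
| "dual_mon (Pre a m) = Pre a (dual_mon m)"
| "dual_mon (Choice m n) = Choice (dual_mon m) (dual_mon n)"
| "dual_mon (Par c m n) = Par (dual_parop c) (dual_mon m) (dual_mon n)"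
| "dual_mon (Rec x m) = Rec x (dual_mon m)"
| "dual_mon (MVar x) = MVar x"

lemma dual_verdict_dual [simp]: "dual_verdict (dual_verdict v) = v"
  by (cases v) auto

lemma dual_parop_dual [simp]: "dual_parop (dual_parop c) = c"
  by (cases c) auto

lemma dual_mon_dual [simp]: "dual_mon (dual_mon m) = m"
  by (induction m) auto

lemma mfv_dual_mon: "mfv (dual_mon m) = mfv m"
  by (induction m) auto

lemma dual_mon_msubst: "dual_mon (msubst p x m) = msubst (dual_mon p) x (dual_mon m)"
  by (induction m) auto

text \<open>The rules for \<open>PAnd\<close> and \<open>POr\<close> mirror each other when
  \<open>Yes\<close> and \<open>No\<close> are exchanged, and unfolding is compatible with this by
  \<open>dual_mon_msubst\<close>.\<close>

lemma step_dual_mon: "step m l n \<Longrightarrow> step (dual_mon m) l (dual_mon n)"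
  by (induction rule: step.induct) (auto intro: step.intros simp: dual_mon_msubst)

lemma reaches_dual_mon: "reaches m s n \<Longrightarrow> reaches (dual_mon m) s (dual_mon n)"
  by (induction rule: reaches.induct) (auto intro: reaches.intros step_dual_mon)

lemma reaches_dual_mon_iff:
  "reaches (dual_mon m) s (Verdict v) \<longleftrightarrow> reaches m s (Verdict (dual_verdict v))"
  using reaches_dual_mon[of m s "Verdict (dual_verdict v)"] reaches_dual_mon[of "dual_mon m" s "Verdict v"]
  by auto

lemma verdict_dual_mon: "accepts (dual_mon m) f \<longleftrightarrow> rejects m f" "rejects (dual_mon m) f \<longleftrightarrow> accepts m f"
  by (cases f; simp add: reaches_dual_mon_iff)+

lemma ex_monitor_dual:
  "(\<exists>m\<in>Mon. sound m P \<and> satisfaction_persistently_informative m) \<longleftrightarrow>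
    (\<exists>m\<in>Mon. sound m (- P) \<and> violation_persistently_informative m)"
proof -
  have "sound (dual_mon m) (- P) \<longleftrightarrow> sound m P" "dual_mon m \<in> Mon \<longleftrightarrow> m \<in> Mon"
    "violation_persistently_informative (dual_mon m) \<longleftrightarrow> satisfaction_persistently_informative m" for m P
    by (auto simp: sound_def Mon_def mfv_dual_mon verdict_dual_mon
        violation_persistently_informative_def satisfaction_persistently_informative_def)
  then show ?thesis by (metis dual_mon_dual)
qed

theorem theorem5:
  fixes \<phi> :: "'a::finite fm"
  assumes "\<phi> \<in> muHML"
  shows "((\<exists>m \<in> Mon. sound m (sem \<phi>) \<and> violation_persistently_informative m) \<longleftrightarrow>
          (\<exists>\<psi> \<in> SPIHML. sem \<psi> = sem \<phi>)) \<and>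
         ((\<exists>m \<in> Mon. sound m (sem \<phi>) \<and> satisfaction_persistently_informative m) \<longleftrightarrow>
          (\<exists>\<psi> \<in> CPIHML. sem \<psi> = sem \<phi>))"
proof
  show "(\<exists>m \<in> Mon. sound m (sem \<phi>) \<and> violation_persistently_informative m) \<longleftrightarrow>
      (\<exists>\<psi> \<in> SPIHML. sem \<psi> = sem \<phi>)"
    by (rule violation_characterisation[OF assms])
  have "sem (dual \<phi>) = - sem \<phi>" using assms by (intro sem_dual) (simp add: muHML_def)
  then show "(\<exists>m \<in> Mon. sound m (sem \<phi>) \<and> satisfaction_persistently_informative m) \<longleftrightarrow>
      (\<exists>\<psi> \<in> CPIHML. sem \<psi> = sem \<phi>)"
    using violation_characterisation[OF muHML_dual[OF assms]]
    unfolding ex_monitor_dual ex_CPIHML_iff[OF assms] by simp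
qed

end
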